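(* The cartesianization of the theory $\mathbb{L}oc$ of local MV-algebras is the theory $\mathbb{MV}$ of MV-algebras.
   Context: An MV-algebra is a structure $(A,\oplus,\neg,0)$ such that $(A,\oplus,0)$ is a commutative monoid, $\neg\neg x=x$, $x\oplus\neg 0=\neg 0$ and $\neg(\neg x\oplus y)\oplus y=\neg(\neg y\oplus x)\oplus x$. Write $1=\neg 0$ and $kx=x\oplus\cdots\oplus x$ ($k$ times). $\mathbb{MV}$ denotes the algebraic theory of MV-algebras. $\mathbb{L}oc$ is the geometric theory obtained from $\mathbb{MV}$ by adding the axioms $(\top\vdash_x\bigvee_{k=1}^{\infty}(kx=1\vee k(\neg x)=1))$ and $(0=1\vdash\bot)$. A cartesian formula relative to a geometric theory $\mathbb{T}$ is one built from atomic formulae using only finitary conjunctions and $\mathbb{T}$-provably unique existential quantifications; a cartesian sequent relative to $\mathbb{T}$ is a sequent between cartesian formulae relative to $\mathbb{T}$. The cartesianization of $\mathbb{T}$ is the cartesian theory consisting of all cartesian sequents over the signature of $\mathbb{T}$ which are provable in $\mathbb{T}$ (in geometric logic). Theories are identified when they prove the same sequents. *)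

theory Defs
  imports Main
begin

text \<open>
  Geometric logic over the one-sorted signature of MV-algebras, whose only atomic formulae are
  equations. Variables are de Bruijn indices: a context of length \<open>n\<close> consists of the
  variables \<open>0, \<dots>, n - 1\<close>, and \<open>Ex\<close> binds index 0.
\<close>

datatype tm = Var nat | Zero | Neg tm | Plus tm tm

text \<open>
  \<open>Disj I F\<close> is the disjunction of the family \<open>(F i)\<close> for \<open>i \<in> I\<close>;
  values of \<open>F\<close> outside \<open>I\<close> are irrelevant. The type parameter \<open>'i\<close> is
  arbitrary, so disjunctions of any cardinality are covered; the summand \<open>nat\<close> ensures
  that countable ones are always available.
\<close>

datatype 'i fm =
    Eq tm tm
  | Top
  | And "'i fm" "'i fm"
  | Ex "'i fm"
  | Disj "('i + nat) set" "('i + nat) \<Rightarrow> 'i fm"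

definition NDisj :: "nat set \<Rightarrow> (nat \<Rightarrow> 'i fm) \<Rightarrow> 'i fm" where
  "NDisj K F = Disj (Inr ` K) (\<lambda>i. F (projr i))"

definition Bot :: "'i fm" where
  "Bot = NDisj {} (\<lambda>_. Top)"

definition Or :: "'i fm \<Rightarrow> 'i fm \<Rightarrow> 'i fm" where
  "Or \<phi> \<psi> = NDisj {0, 1} (\<lambda>k. if k = 0 then \<phi> else \<psi>)"

primrec wf_tm :: "nat \<Rightarrow> tm \<Rightarrow> bool" where
  "wf_tm n (Var i) \<longleftrightarrow> i < n"
| "wf_tm n Zero \<longleftrightarrow> True"
| "wf_tm n (Neg t) \<longleftrightarrow> wf_tm n t"
| "wf_tm n (Plus s t) \<longleftrightarrow> wf_tm n s \<and> wf_tm n t"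

primrec wf_fm :: "nat \<Rightarrow> 'i fm \<Rightarrow> bool" where
  "wf_fm n (Eq s t) \<longleftrightarrow> wf_tm n s \<and> wf_tm n t"
| "wf_fm n Top \<longleftrightarrow> True"
| "wf_fm n (And \<phi> \<psi>) \<longleftrightarrow> wf_fm n \<phi> \<and> wf_fm n \<psi>"
| "wf_fm n (Ex \<phi>) \<longleftrightarrow> wf_fm (Suc n) \<phi>"
| "wf_fm n (Disj I F) \<longleftrightarrow> (\<forall>i\<in>I. wf_fm n (F i))"

primrec subst_tm :: "(nat \<Rightarrow> tm) \<Rightarrow> tm \<Rightarrow> tm" where
  "subst_tm s (Var i) = s i"
| "subst_tm s Zero = Zero"
| "subst_tm s (Neg t) = Neg (subst_tm s t)"
| "subst_tm s (Plus t u) = Plus (subst_tm s t) (subst_tm s u)"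

definition shift :: "nat \<Rightarrow> tm" where
  "shift i = Var (Suc i)"

definition lift_subst :: "(nat \<Rightarrow> tm) \<Rightarrow> nat \<Rightarrow> tm" where
  "lift_subst s i = (case i of 0 \<Rightarrow> Var 0 | Suc j \<Rightarrow> subst_tm shift (s j))"

primrec subst_fm :: "(nat \<Rightarrow> tm) \<Rightarrow> 'i fm \<Rightarrow> 'i fm" where
  "subst_fm s (Eq t u) = Eq (subst_tm s t) (subst_tm s u)"
| "subst_fm s Top = Top"
| "subst_fm s (And \<phi> \<psi>) = And (subst_fm s \<phi>) (subst_fm s \<psi>)"
| "subst_fm s (Ex \<phi>) = Ex (subst_fm (lift_subst s) \<phi>)"
| "subst_fm s (Disj I F) = Disj I (\<lambda>i. subst_fm s (F i))"

text \<open>\<open>Seq n \<phi> \<psi>\<close> is the sequent from \<open>\<phi>\<close> to \<open>\<psi>\<close> in the context of length \<open>n\<close>.\<close>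

datatype 'i seq = Seq nat "'i fm" "'i fm"

primrec wf_seq :: "'i seq \<Rightarrow> bool" where
  "wf_seq (Seq n \<phi> \<psi>) \<longleftrightarrow> wf_fm n \<phi> \<and> wf_fm n \<psi>"

text \<open>
  The sequent calculus of geometric logic (Johnstone, Sketches of an Elephant, D1.3.1). The
  well-formedness premises make every derivable sequent well-formed in its context.
\<close>

inductive derivable :: "'i seq set \<Rightarrow> 'i seq \<Rightarrow> bool" (infix \<open>\<turnstile>\<close> 50) for T where
  ax: "\<sigma> \<in> T \<Longrightarrow> wf_seq \<sigma> \<Longrightarrow> T \<turnstile> \<sigma>"
| ident: "wf_fm n \<phi> \<Longrightarrow> T \<turnstile> Seq n \<phi> \<phi>"
| subst: "T \<turnstile> Seq n \<phi> \<psi> \<Longrightarrow> (\<And>i. i < n \<Longrightarrow> wf_tm m (s i)) \<Longrightarrow>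
    T \<turnstile> Seq m (subst_fm s \<phi>) (subst_fm s \<psi>)"
| cut: "T \<turnstile> Seq n \<phi> \<psi> \<Longrightarrow> T \<turnstile> Seq n \<psi> \<chi> \<Longrightarrow> T \<turnstile> Seq n \<phi> \<chi>"
| eq_refl: "i < n \<Longrightarrow> T \<turnstile> Seq n Top (Eq (Var i) (Var i))"
| eq_subst: "i < n \<Longrightarrow> j < n \<Longrightarrow> wf_fm n \<phi> \<Longrightarrow>
    T \<turnstile> Seq n (And (Eq (Var i) (Var j)) \<phi>) (subst_fm (Var(i := Var j)) \<phi>)"
| top: "wf_fm n \<phi> \<Longrightarrow> T \<turnstile> Seq n \<phi> Top"
| and_left: "wf_fm n \<phi> \<Longrightarrow> wf_fm n \<psi> \<Longrightarrow> T \<turnstile> Seq n (And \<phi> \<psi>) \<phi>"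
| and_right: "wf_fm n \<phi> \<Longrightarrow> wf_fm n \<psi> \<Longrightarrow> T \<turnstile> Seq n (And \<phi> \<psi>) \<psi>"
| and_intro: "T \<turnstile> Seq n \<phi> \<psi> \<Longrightarrow> T \<turnstile> Seq n \<phi> \<chi> \<Longrightarrow> T \<turnstile> Seq n \<phi> (And \<psi> \<chi>)"
| disj_intro: "wf_fm n (Disj I F) \<Longrightarrow> i \<in> I \<Longrightarrow> T \<turnstile> Seq n (F i) (Disj I F)"
| disj_elim: "wf_fm n \<chi> \<Longrightarrow> (\<And>i. i \<in> I \<Longrightarrow> T \<turnstile> Seq n (F i) \<chi>) \<Longrightarrow>
    T \<turnstile> Seq n (Disj I F) \<chi>"
| ex_elim: "wf_fm n \<psi> \<Longrightarrow> T \<turnstile> Seq (Suc n) \<phi> (subst_fm shift \<psi>) \<Longrightarrow> T \<turnstile> Seq n (Ex \<phi>) \<psi>"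
| ex_intro: "T \<turnstile> Seq n (Ex \<phi>) \<psi> \<Longrightarrow> T \<turnstile> Seq (Suc n) \<phi> (subst_fm shift \<psi>)"
| distrib: "wf_fm n \<phi> \<Longrightarrow> wf_fm n (Disj I F) \<Longrightarrow>
    T \<turnstile> Seq n (And \<phi> (Disj I F)) (Disj I (\<lambda>i. And \<phi> (F i)))"
| frobenius: "wf_fm n \<phi> \<Longrightarrow> wf_fm n (Ex \<psi>) \<Longrightarrow>
    T \<turnstile> Seq n (And \<phi> (Ex \<psi>)) (Ex (And (subst_fm shift \<phi>) \<psi>))"

definition same_theory :: "'i seq set \<Rightarrow> 'i seq set \<Rightarrow> bool" where
  "same_theory T U \<longleftrightarrow> (\<forall>\<sigma>. T \<turnstile> \<sigma> \<longleftrightarrow> U \<turnstile> \<sigma>)"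

text \<open>
  For \<open>\<phi>(x, y)\<close> in a context \<open>(x, y)\<close> of length \<open>n + 1\<close>, with \<open>y\<close> the
  variable 0: the sequent from \<open>\<phi>(x, y)\<close> and \<open>\<phi>(x, y')\<close> to \<open>y = y'\<close>. In its
  context of length \<open>n + 2\<close>, \<open>y\<close> is the variable 1, \<open>y'\<close> is the variable 0, and
  the variables of \<open>x\<close> start at 2.
\<close>

definition uniqueness_seq :: "nat \<Rightarrow> 'i fm \<Rightarrow> 'i seq" where
  "uniqueness_seq n \<phi> =
     Seq (n + 2)
       (And (subst_fm shift \<phi>)
            (subst_fm (\<lambda>i. case i of 0 \<Rightarrow> Var 0 | Suc j \<Rightarrow> Var (j + 2)) \<phi>))
       (Eq (Var 1) (Var 0))"

inductive cartesian_fm :: "'i seq set \<Rightarrow> nat \<Rightarrow> 'i fm \<Rightarrow> bool" for T where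
  "wf_tm n s \<Longrightarrow> wf_tm n t \<Longrightarrow> cartesian_fm T n (Eq s t)"
| "cartesian_fm T n Top"
| "cartesian_fm T n \<phi> \<Longrightarrow> cartesian_fm T n \<psi> \<Longrightarrow> cartesian_fm T n (And \<phi> \<psi>)"
| "cartesian_fm T (Suc n) \<phi> \<Longrightarrow> T \<turnstile> uniqueness_seq n \<phi> \<Longrightarrow> cartesian_fm T n (Ex \<phi>)"

primrec cartesian_seq :: "'i seq set \<Rightarrow> 'i seq \<Rightarrow> bool" where
  "cartesian_seq T (Seq n \<phi> \<psi>) \<longleftrightarrow> cartesian_fm T n \<phi> \<and> cartesian_fm T n \<psi>"

definition cartesianization :: "'i seq set \<Rightarrow> 'i seq set" where
  "cartesianization T = {\<sigma>. cartesian_seq T \<sigma> \<and> T \<turnstile> \<sigma>}"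

abbreviation One :: tm where
  "One \<equiv> Neg Zero"

fun times_tm :: "nat \<Rightarrow> tm \<Rightarrow> tm" where
  "times_tm 0 t = Zero"
| "times_tm (Suc 0) t = t"
| "times_tm (Suc (Suc k)) t = Plus (times_tm (Suc k) t) t"

definition MV :: "'i seq set" where
  "MV = (let x = Var 0; y = Var 1; z = Var 2 in
     {Seq 3 Top (Eq (Plus x (Plus y z)) (Plus (Plus x y) z)),
      Seq 2 Top (Eq (Plus x y) (Plus y x)),
      Seq 1 Top (Eq (Plus x Zero) x),
      Seq 1 Top (Eq (Neg (Neg x)) x),
      Seq 1 Top (Eq (Plus x (Neg Zero)) (Neg Zero)),
      Seq 2 Top (Eq (Plus (Neg (Plus (Neg x) y)) y) (Plus (Neg (Plus (Neg y) x)) x))})"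

definition Loc :: "'i seq set" where
  "Loc = MV \<union>
     {Seq 1 Top (NDisj {1..} (\<lambda>k. Or (Eq (times_tm k (Var 0)) One)
                                       (Eq (times_tm k (Neg (Var 0))) One))),
      Seq 0 (Eq Zero One) Bot}"

end

theory Submission
  imports Defs
begin

text \<open>
  The axioms of MV-algebras are cartesian sequents and belong to \<open>Loc\<close>, so only one direction
  has content: a cartesian sequent that geometric logic derives from \<open>Loc\<close> is derivable from
  \<open>MV\<close> alone. Geometrically the reason is that every MV-algebra is the algebra of global
  sections of a sheaf of local MV-algebras on its prime spectrum, and that taking global sections
  preserves cartesian formulae. The proof replaces the sheaf by its forcing relation over the
  lattice of ideals, so that neither points nor stalks appear.

  Fix an MV-algebra \<open>A\<close>. An ideal \<open>I\<close> stands for the set of primes containing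
  it, over which the sections are the elements of \<open>A / I\<close>. A condition \<open>I\<close> is covered
  by \<open>I + (a \<ominus> b)\<close> and \<open>I + (b \<ominus> a)\<close>, which force \<open>a \<le> b\<close> and
  \<open>b \<le> a\<close> respectively, and the improper ideal is covered by nothing. Forcing interprets an
  equation as congruence modulo \<open>I\<close>, and an existential quantifier or a disjunction as the
  existence of witnesses on a covering. Two facts from the theory of MV-algebras make this a sheaf
  semantics. By prelinearity, \<open>a \<ominus> b\<close> and \<open>b \<ominus> a\<close> are disjoint, so
  \<open>I\<close> is the intersection of the two larger ideals and congruence is a local property
  (\<open>covered_mem\<close>). Elements that are compatible modulo the two larger ideals can be glued by
  an explicit term (\<open>glue_two\<close>). Geometric logic is sound for forcing (\<open>soundness\<close>),
  and the axioms of \<open>Loc\<close> are forced: on the two members of the covering given by \<open>x\<close>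
  and \<open>- x\<close> one has \<open>2 (- x) = 1\<close> or \<open>2 x = 1\<close> (\<open>Loc_holds_in\<close>).

  Derivability from \<open>MV\<close> enters by taking the free MV-algebra on countably many variables for
  \<open>A\<close>. A formula \<open>\<theta>\<close> in a context of length \<open>m\<close> gives the ideal of those terms
  which \<open>\<theta>\<close> proves to be zero, so that forcing an equation at this ideal is the same as
  deriving it from \<open>\<theta>\<close>. Let \<open>\<phi>\<close> be a cartesian formula. If the ideal of
  \<open>\<theta>\<close> forces \<open>\<phi>\<close>, then \<open>\<theta>\<close> proves \<open>\<phi>\<close> over \<open>MV\<close>
  (\<open>forced_imp_derivable\<close>): uniqueness of the witness of an existential quantifier lets local
  witnesses be glued to a single term. Conversely, to derive \<open>\<chi>\<close> from \<open>\<phi>\<close> it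
  suffices to derive it from every \<open>\<theta>\<close> whose ideal forces \<open>\<phi>\<close>
  (\<open>derivable_from_generic\<close>). For a cartesian sequent from \<open>\<phi>\<close> to \<open>\<psi>\<close> that
  is provable in \<open>Loc\<close>, soundness turns forcing of \<open>\<phi>\<close> into forcing of
  \<open>\<psi>\<close>, and the two statements together yield a derivation in \<open>MV\<close>.
\<close>

section \<open>MV-algebras and prelinearity\<close>


class mv_algebra = comm_monoid_add + uminus +
  assumes neg_neg [simp]: "- (- x) = x"
    and add_one [simp]: "x + - 0 = - 0"
    and lukasiewicz: "- (- x + y) + y = - (- y + x) + x"

definition monus :: "'a::mv_algebra \<Rightarrow> 'a \<Rightarrow> 'a" (infixl \<open>\<ominus>\<close> 65) where
  "x \<ominus> y = - (- x + y)"

definition below :: "'a::mv_algebra \<Rightarrow> 'a \<Rightarrow> bool" (infix \<open>\<sqsubseteq>\<close> 50) where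
  "x \<sqsubseteq> y \<longleftrightarrow> x \<ominus> y = 0"

lemma one_add [simp]: "- 0 + x = - (0::'a::mv_algebra)"
  by (metis add_one add.commute)

lemma neg_eq_iff [simp]: "- x = - y \<longleftrightarrow> x = (y::'a::mv_algebra)"
  by (metis neg_neg)

lemma add_neg: "x + - x = - (0::'a::mv_algebra)"
  using lukasiewicz[of x "- 0"] by (simp add: add.commute)

lemma below_iff: "x \<sqsubseteq> y \<longleftrightarrow> - x + y = - 0"
  unfolding below_def monus_def by (metis neg_neg)

lemma join_commute: "(x \<ominus> y) + y = (y \<ominus> x) + x"
  unfolding monus_def by (rule lukasiewicz)

lemma monus_below_iff: "x \<ominus> y \<sqsubseteq> z \<longleftrightarrow> x \<sqsubseteq> y + z"
  unfolding below_iff monus_def by (simp add: add.assoc)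

lemma monus_zero [simp]: "x \<ominus> 0 = x"
  by (simp add: monus_def)

lemma zero_below [simp]: "0 \<sqsubseteq> x"
  by (simp add: below_iff)

lemma below_refl [simp]: "x \<sqsubseteq> x"
  using add_neg[of x] by (simp add: below_iff add.commute)

lemma below_imp_add: "x \<sqsubseteq> y \<Longrightarrow> x + (y \<ominus> x) = y"
  using join_commute[of x y] by (simp add: below_def add.commute)

lemma below_add [simp]: "x \<sqsubseteq> x + y" "y \<sqsubseteq> x + y"
proof -
  show *: "x \<sqsubseteq> x + y" for x y :: 'a
    using add_neg[of x] by (simp add: below_iff add.assoc[symmetric] add.commute[of "- x"])
  show "y \<sqsubseteq> x + y"
    using *[of y x] by (simp add: add.commute)
qed

lemma below_one [simp]: "x \<sqsubseteq> - 0"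
  by (simp add: below_iff)

lemma below_trans [trans]: "x \<sqsubseteq> y \<Longrightarrow> y \<sqsubseteq> z \<Longrightarrow> x \<sqsubseteq> z"
  using below_add(1)[of x "(y \<ominus> x) + (z \<ominus> y)"] below_imp_add[of x y] below_imp_add[of y z]
  by (simp add: add.assoc[symmetric])

lemma below_zero [simp]: "x \<sqsubseteq> 0 \<longleftrightarrow> x = 0"
  by (simp add: below_def)

lemma add_mono: "x \<sqsubseteq> y \<Longrightarrow> u \<sqsubseteq> v \<Longrightarrow> x + u \<sqsubseteq> y + v"
proof -
  assume "x \<sqsubseteq> y" "u \<sqsubseteq> v"
  then have "y + v = (x + (y \<ominus> x)) + (u + (v \<ominus> u))"
    using below_imp_add[of x y] below_imp_add[of u v] by presburger
  also have "\<dots> = (x + u) + ((y \<ominus> x) + (v \<ominus> u))"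
    by (simp only: ac_simps)
  finally show ?thesis by simp
qed

lemma monus_below [simp]: "x \<ominus> y \<sqsubseteq> x"
  by (simp add: monus_below_iff)

lemma below_add_monus: "x \<sqsubseteq> y + (x \<ominus> y)"
  using monus_below_iff below_refl by blast

lemma meet_commute: "x \<ominus> (x \<ominus> y) = y \<ominus> (y \<ominus> x)"
  using join_commute[of "- x" "- y"] unfolding monus_def by (simp add: add.commute)

lemma meet_below_right [simp]: "x \<ominus> (x \<ominus> y) \<sqsubseteq> y"
  by (metis meet_commute monus_below)

lemma monus_mono: "x \<sqsubseteq> x' \<Longrightarrow> x \<ominus> y \<sqsubseteq> x' \<ominus> y"
  by (metis monus_below_iff below_trans below_add_monus)

lemma meet_eq: "z \<sqsubseteq> x \<Longrightarrow> x \<ominus> (x \<ominus> z) = z"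
  by (metis meet_commute monus_zero below_def)

lemma monus_antimono: "y \<sqsubseteq> y' \<Longrightarrow> x \<ominus> y' \<sqsubseteq> x \<ominus> y"
  by (metis monus_below_iff below_trans below_add_monus add_mono below_refl)

lemma meet_greatest: "z \<sqsubseteq> x \<Longrightarrow> z \<sqsubseteq> y \<Longrightarrow> z \<sqsubseteq> x \<ominus> (x \<ominus> y)"
  by (metis meet_eq monus_antimono)

definition strong_conj :: "'a::mv_algebra \<Rightarrow> 'a \<Rightarrow> 'a" (infixl \<open>\<odot>\<close> 70) where
  "x \<odot> y = - (- x + - y)"

lemma strong_conj_commute: "x \<odot> y = y \<odot> x"
  by (simp add: strong_conj_def add.commute)

lemma strong_conj_assoc: "(x \<odot> y) \<odot> z = x \<odot> (y \<odot> z)"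
  by (simp add: strong_conj_def add.assoc)

lemma strong_conj_left_commute: "x \<odot> (y \<odot> z) = y \<odot> (x \<odot> z)"
  by (simp add: strong_conj_def add.left_commute)

lemma strong_conj_below: "x \<odot> y \<sqsubseteq> x" "x \<odot> y \<sqsubseteq> y"
  using monus_below[of x "- y"] monus_below[of y "- x"]
  by (simp_all add: strong_conj_def monus_def add.commute)

lemma strong_conj_mono: "x \<sqsubseteq> y \<Longrightarrow> z \<odot> x \<sqsubseteq> z \<odot> y"
  using monus_mono[of x y "- z"] by (simp add: strong_conj_def monus_def add.commute)

lemma meet_conv_strong_conj: "x \<ominus> (x \<ominus> y) = x \<odot> (- x + y)"
  by (simp add: strong_conj_def monus_def)

lemma strong_conj_commute_meet: "x \<odot> (- x + y) = y \<odot> (- y + x)"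
  using meet_commute[of x y] by (simp add: meet_conv_strong_conj)

text \<open>
  Repeated use of the commutativity of the meet \<open>x \<odot> (- x + y)\<close> rewrites
  \<open>(x \<ominus> y) \<and> (y \<ominus> x)\<close> until it exhibits a factor \<open>- x\<close> next to a factor
  below \<open>x\<close>.
\<close>

lemma prelinearity_meet: "(x \<ominus> y) \<ominus> ((x \<ominus> y) \<ominus> (y \<ominus> x)) = 0"
proof -
  define b where "b = y \<odot> - x"
  define c where "c = - x + b"
  have b: "y \<ominus> x = b" and a: "x \<ominus> y = x \<odot> - y"
    by (simp_all add: b_def monus_def strong_conj_def add.commute)
  have "(x \<ominus> y) \<ominus> ((x \<ominus> y) \<ominus> (y \<ominus> x)) = (x \<odot> - y) \<odot> (- (x \<odot> - y) + b)"
    by (simp only: a b meet_conv_strong_conj)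
  also have "- (x \<odot> - y) + b = - (- y) + c"
    by (simp add: strong_conj_def c_def ac_simps)
  also have "(x \<odot> - y) \<odot> (- (- y) + c) = x \<odot> (c \<odot> (- c + - y))"
    by (simp only: strong_conj_assoc strong_conj_commute_meet[of "- y" c])
  also have "\<dots> = (x \<odot> c) \<odot> (- c + - y)"
    by (simp only: strong_conj_assoc)
  also have "x \<odot> c = b \<odot> (- b + x)"
    by (simp only: c_def strong_conj_commute_meet[of x b])
  also have "(b \<odot> (- b + x)) \<odot> (- c + - y) = (- b + x) \<odot> (- x \<odot> (y \<odot> (- y + - c)))"
    unfolding b_def
    by (simp only: strong_conj_assoc strong_conj_commute strong_conj_left_commute add.commute)
  also have "\<dots> \<sqsubseteq> - x \<odot> (y \<odot> (- y + - c))"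
    by (rule strong_conj_below)
  also have "\<dots> \<sqsubseteq> - x \<odot> - c"
    by (intro strong_conj_mono) (metis meet_conv_strong_conj meet_below_right)
  also have "\<dots> \<sqsubseteq> - x \<odot> x"
  proof (rule strong_conj_mono)
    have "- c = x \<odot> - b" by (simp add: c_def strong_conj_def)
    then show "- c \<sqsubseteq> x" by (simp add: strong_conj_below)
  qed
  also have "- x \<odot> x = 0"
    using add_neg[of x] by (simp add: strong_conj_def)
  finally show ?thesis by simp
qed

text \<open>
  In every linearly ordered MV-algebra one of \<open>x \<ominus> y\<close> and \<open>y \<ominus> x\<close> is zero; the
  disjointness of the two elements is the form in which this holds in all MV-algebras.
\<close>

lemma prelinearity: "z \<sqsubseteq> x \<ominus> y \<Longrightarrow> z \<sqsubseteq> y \<ominus> x \<Longrightarrow> z = 0"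
  using meet_greatest prelinearity_meet below_zero by metis


primrec nmult :: "nat \<Rightarrow> 'a::mv_algebra \<Rightarrow> 'a" where
  "nmult 0 a = 0"
| "nmult (Suc n) a = a + nmult n a"

lemma nmult_add: "nmult (m + n) a = nmult m a + nmult n a"
  by (induction m) (simp_all add: add.assoc)

definition disjoint :: "'a::mv_algebra \<Rightarrow> 'a \<Rightarrow> bool" where
  "disjoint u v \<longleftrightarrow> (\<forall>z. z \<sqsubseteq> u \<longrightarrow> z \<sqsubseteq> v \<longrightarrow> z = 0)"

lemma disjointD: "disjoint u v \<Longrightarrow> z \<sqsubseteq> u \<Longrightarrow> z \<sqsubseteq> v \<Longrightarrow> z = 0"
  by (auto simp: disjoint_def)

lemma disjoint_sym: "disjoint u v \<Longrightarrow> disjoint v u"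
  by (auto simp: disjoint_def)

text \<open>
  An element below \<open>u + w\<close> is below \<open>u\<close> up to a difference that is bounded by
  \<open>w\<close>, and that difference vanishes if the element is below \<open>v\<close>.
\<close>

lemma disjoint_add: 
  assumes "disjoint u v" "disjoint w v"
  shows "disjoint (u + w) v"
  unfolding disjoint_def
proof (intro allI impI)
  fix z assume z: "z \<sqsubseteq> u + w" "z \<sqsubseteq> v"
  have "z \<ominus> u \<sqsubseteq> w" "z \<ominus> u \<sqsubseteq> v"
    using z by (simp add: monus_below_iff, meson monus_below below_trans)
  then have "z \<ominus> u = 0" by (rule disjointD[OF assms(2)])
  then have "z \<sqsubseteq> u" by (simp add: below_def)
  then show "z = 0" using z(2) by (rule disjointD[OF assms(1)])
qed

lemma disjoint_nmult: "disjoint u v \<Longrightarrow> disjoint (nmult m u) v"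
  by (induction m) (simp_all add: disjoint_add, simp add: disjoint_def)

lemma disjoint_monus: "disjoint (a \<ominus> b) (b \<ominus> a)"
  unfolding disjoint_def using prelinearity by blast

section \<open>Ideals and their congruences\<close>

definition ideal :: "'a::mv_algebra set \<Rightarrow> bool" where
  "ideal I \<longleftrightarrow> 0 \<in> I \<and> (\<forall>x\<in>I. \<forall>y\<in>I. x + y \<in> I) \<and> (\<forall>x y. x \<sqsubseteq> y \<longrightarrow> y \<in> I \<longrightarrow> x \<in> I)"

lemma ideal_zero: "ideal I \<Longrightarrow> 0 \<in> I"
  and ideal_add: "ideal I \<Longrightarrow> x \<in> I \<Longrightarrow> y \<in> I \<Longrightarrow> x + y \<in> I"
  and ideal_below: "ideal I \<Longrightarrow> y \<in> I \<Longrightarrow> x \<sqsubseteq> y \<Longrightarrow> x \<in> I"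
  by (auto simp: ideal_def)

definition congr :: "'a::mv_algebra set \<Rightarrow> 'a \<Rightarrow> 'a \<Rightarrow> bool" where
  "congr I x y \<longleftrightarrow> x \<ominus> y \<in> I \<and> y \<ominus> x \<in> I"

lemma congr_refl: "ideal I \<Longrightarrow> congr I x x"
  using below_refl[of x] unfolding below_def congr_def by (simp add: ideal_zero)

lemma congr_sym: "congr I x y \<Longrightarrow> congr I y x"
  by (simp add: congr_def)

lemma monus_triangle: "x \<ominus> z \<sqsubseteq> (x \<ominus> y) + (y \<ominus> z)"
proof -
  have "x \<sqsubseteq> y + (x \<ominus> y)" by (rule below_add_monus)
  also have "\<dots> \<sqsubseteq> (z + (y \<ominus> z)) + (x \<ominus> y)"
    by (intro add_mono below_add_monus below_refl)
  finally show ?thesis by (simp add: monus_below_iff ac_simps)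
qed

lemma congr_trans: "ideal I \<Longrightarrow> congr I x y \<Longrightarrow> congr I y z \<Longrightarrow> congr I x z"
  unfolding congr_def using ideal_below[OF _ ideal_add monus_triangle] by blast

lemma congr_neg: "congr I x y \<Longrightarrow> congr I (- x) (- y)"
  by (simp add: congr_def monus_def add.commute)

lemma add_monus_add: "(x + u) \<ominus> (y + v) \<sqsubseteq> (x \<ominus> y) + (u \<ominus> v)"
proof -
  have "x + u \<sqsubseteq> (y + (x \<ominus> y)) + (v + (u \<ominus> v))"
    by (intro add_mono below_add_monus)
  then show ?thesis by (simp add: monus_below_iff ac_simps)
qed

lemma congr_add: "ideal I \<Longrightarrow> congr I x y \<Longrightarrow> congr I u v \<Longrightarrow> congr I (x + u) (y + v)"
  unfolding congr_def using ideal_below[OF _ ideal_add add_monus_add] by blast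

lemma congr_monus: "ideal I \<Longrightarrow> congr I x y \<Longrightarrow> congr I u v \<Longrightarrow> congr I (x \<ominus> u) (y \<ominus> v)"
  unfolding monus_def by (intro congr_neg congr_add)

lemma congr_zero_iff: "ideal I \<Longrightarrow> congr I x 0 \<longleftrightarrow> x \<in> I"
  using zero_below[of x] unfolding below_def congr_def by (simp add: ideal_zero)

lemma congr_subset: "congr I x y \<Longrightarrow> I \<subseteq> J \<Longrightarrow> congr J x y"
  by (auto simp: congr_def)

text \<open>The ideal generated by \<open>I\<close> and \<open>a\<close>.\<close>

definition adjoin :: "'a::mv_algebra \<Rightarrow> 'a set \<Rightarrow> 'a set" where
  "adjoin a I = {x. \<exists>i\<in>I. \<exists>n. x \<sqsubseteq> i + nmult n a}"

lemma ideal_adjoin: assumes "ideal I" shows "ideal (adjoin a I)"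
  unfolding ideal_def
proof (intro conjI ballI allI impI)
  show "0 \<in> adjoin a I" using assms by (auto simp: adjoin_def ideal_def)
  fix x y assume "x \<in> adjoin a I" "y \<in> adjoin a I"
  then obtain i j m n where ij: "i \<in> I" "j \<in> I" and "x \<sqsubseteq> i + nmult m a" "y \<sqsubseteq> j + nmult n a"
    unfolding adjoin_def by blast
  then have "x + y \<sqsubseteq> (i + nmult m a) + (j + nmult n a)" by (intro add_mono)
  then have "x + y \<sqsubseteq> (i + j) + nmult (m + n) a" by (simp add: nmult_add ac_simps)
  then show "x + y \<in> adjoin a I" using ij assms unfolding adjoin_def by (blast intro: ideal_add)
next
  fix x y assume "x \<sqsubseteq> y" "y \<in> adjoin a I"
  then show "x \<in> adjoin a I" unfolding adjoin_def by (blast intro: below_trans)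
qed

lemma subset_adjoin: "I \<subseteq> adjoin a I"
proof
  fix x assume "x \<in> I"
  moreover have "x \<sqsubseteq> x + nmult 0 a" by simp
  ultimately show "x \<in> adjoin a I" unfolding adjoin_def by blast
qed

lemma mem_adjoin: "ideal I \<Longrightarrow> a \<in> adjoin a I"
  unfolding adjoin_def using ideal_zero[of I]
  by (auto intro!: bexI[of _ 0] exI[of _ 1])

lemma nmult_mem: "ideal I \<Longrightarrow> a \<in> I \<Longrightarrow> nmult n a \<in> I"
  by (induction n) (auto intro: ideal_zero ideal_add)

lemma adjoin_least: "ideal J \<Longrightarrow> I \<subseteq> J \<Longrightarrow> a \<in> J \<Longrightarrow> adjoin a I \<subseteq> J"
  unfolding adjoin_def by (blast intro: ideal_below ideal_add nmult_mem)

text \<open>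
  This is the separatedness of the structure sheaf: an element that vanishes on both members of a
  two-element covering vanishes. If \<open>x \<sqsubseteq> i + m u\<close> and \<open>x \<sqsubseteq> i + n v\<close> with
  \<open>i\<close> in the ideal, then \<open>x \<ominus> i\<close> is below the disjoint elements \<open>m u\<close> and
  \<open>n v\<close>.
\<close>

lemma adjoin_disjoint:
  assumes "ideal I" "disjoint u v" "x \<in> adjoin u I" "x \<in> adjoin v I"
  shows "x \<in> I"
proof -
  obtain i j m n where ij: "i \<in> I" "j \<in> I"
    and x: "x \<sqsubseteq> i + nmult m u" "x \<sqsubseteq> j + nmult n v"
    using assms(3,4) unfolding adjoin_def by blast
  have "x \<sqsubseteq> (i + j) + nmult m u" "x \<sqsubseteq> (i + j) + nmult n v"
    using x by (metis below_trans add_mono below_refl below_add)+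
  then have "x \<ominus> (i + j) \<sqsubseteq> nmult m u" "x \<ominus> (i + j) \<sqsubseteq> nmult n v"
    by (simp_all add: monus_below_iff)
  moreover have "disjoint (nmult m u) (nmult n v)"
    by (rule disjoint_nmult, rule disjoint_sym, rule disjoint_nmult, rule disjoint_sym, rule assms)
  ultimately have "x \<ominus> (i + j) = 0" by (auto dest: disjointD)
  then have "x \<sqsubseteq> i + j" by (simp add: below_def)
  then show ?thesis using assms(1) ij by (blast intro: ideal_add ideal_below)
qed

lemma congr_meet:
  assumes "ideal I" "x \<ominus> y \<in> I" shows "congr I (x \<ominus> (x \<ominus> y)) x"
proof -
  have "congr I (x \<ominus> (x \<ominus> y)) (x \<ominus> 0)"
    using assms by (intro congr_monus congr_refl) (auto simp: congr_zero_iff)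
  then show ?thesis by simp
qed

lemma congr_join:
  assumes "ideal I" "x \<ominus> y \<in> I" shows "congr I ((x \<ominus> y) + y) y"
proof -
  have "congr I ((x \<ominus> y) + y) (0 + y)"
    using assms by (intro congr_add congr_refl) (auto simp: congr_zero_iff)
  then show ?thesis by simp
qed

text \<open>
  The gluing property for a two-element covering. Compatibility bounds the distance of \<open>s\<close> and
  \<open>t\<close> by a multiple \<open>w\<close> of \<open>v\<close>, modulo \<open>u\<close>. The glued element is \<open>s\<close>
  truncated to the interval from \<open>t \<ominus> w\<close> to \<open>t + w\<close>: modulo \<open>u\<close> the element
  \<open>s\<close> already lies in this interval, and modulo \<open>v\<close> the interval shrinks to
  \<open>t\<close>.
\<close>

lemma glue_two:
  assumes I: "ideal I" and st: "congr (adjoin v (adjoin u I)) s t"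
  shows "\<exists>r. congr (adjoin u I) r s \<and> congr (adjoin v I) r t"
proof -
  let ?K = "adjoin u I" and ?L = "adjoin v I"
  have K: "ideal ?K" and L: "ideal ?L" using I by (auto intro: ideal_adjoin)
  obtain i j m n where ij: "i \<in> ?K" "j \<in> ?K"
    and d: "s \<ominus> t \<sqsubseteq> i + nmult m v" "t \<ominus> s \<sqsubseteq> j + nmult n v"
    using st unfolding congr_def adjoin_def[of v] by blast
  define w where "w = nmult (m + n) v"
  have w: "w \<in> ?L" unfolding w_def by (intro nmult_mem L mem_adjoin I)
  have "s \<ominus> t \<sqsubseteq> i + w" "t \<ominus> s \<sqsubseteq> j + w"
    unfolding w_def nmult_add using d by (metis below_trans add_mono below_refl below_add)+
  then have "s \<ominus> (t + w) \<sqsubseteq> i" "(t \<ominus> w) \<ominus> s \<sqsubseteq> j"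
    by (simp_all add: monus_below_iff ac_simps)
  then have sK: "s \<ominus> (t + w) \<in> ?K" "(t \<ominus> w) \<ominus> s \<in> ?K"
    using ij K by (blast intro: ideal_below)+
  define p where "p = s \<ominus> (s \<ominus> (t + w))"
  define r where "r = ((t \<ominus> w) \<ominus> p) + p"
  have ps: "congr ?K p s" unfolding p_def using sK K by (intro congr_meet)
  have "congr ?K r (((t \<ominus> w) \<ominus> s) + s)"
    unfolding r_def using ps K by (intro congr_add congr_monus congr_refl)
  then have 1: "congr ?K r s"
    using congr_join[OF K sK(2)] congr_trans[OF K] by blast
  have w0: "congr ?L w 0" using w L by (simp add: congr_zero_iff)
  have tw: "congr ?L (t + w) t" "congr ?L (t \<ominus> w) t"
    using congr_add[OF L congr_refl[OF L, of t] w0] congr_monus[OF L congr_refl[OF L, of t] w0]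
    by simp_all
  let ?q = "s \<ominus> (s \<ominus> t)"
  have pq: "congr ?L p ?q" unfolding p_def using tw L by (intro congr_monus congr_refl)
  have "congr ?L r ((t \<ominus> ?q) + ?q)"
    unfolding r_def using pq tw L by (intro congr_add congr_monus)
  moreover have "(t \<ominus> ?q) + ?q = t"
    using meet_below_right[of s t] by (simp add: below_imp_add add.commute)
  ultimately show ?thesis using 1 by auto
qed

section \<open>Coverings and gluing\<close>

text \<open>
  \<open>covered P I\<close> says that \<open>P\<close> holds on the leaves of some finite covering tree of
  \<open>I\<close>; the topology is generated by the comparisons of two elements.
\<close>

inductive covered :: "('a::mv_algebra set \<Rightarrow> bool) \<Rightarrow> 'a set \<Rightarrow> bool" for P where
  leaf: "P I \<Longrightarrow> covered P I"
| improper: "- 0 \<in> I \<Longrightarrow> covered P I"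
| split: "covered P (adjoin (a \<ominus> b) I) \<Longrightarrow> covered P (adjoin (b \<ominus> a) I) \<Longrightarrow> covered P I"

definition mv_hom :: "('a::mv_algebra \<Rightarrow> 'b::mv_algebra) \<Rightarrow> bool" where
  "mv_hom f \<longleftrightarrow> f 0 = 0 \<and> (\<forall>x. f (- x) = - f x) \<and> (\<forall>x y. f (x + y) = f x + f y)"

lemma mv_hom_monus: "mv_hom f \<Longrightarrow> f (x \<ominus> y) = f x \<ominus> f y"
  by (simp add: mv_hom_def monus_def)

lemma mv_hom_below: "mv_hom f \<Longrightarrow> x \<sqsubseteq> y \<Longrightarrow> f x \<sqsubseteq> f y"
  by (metis below_def mv_hom_monus mv_hom_def)

lemma mv_hom_nmult: "mv_hom f \<Longrightarrow> f (nmult n a) = nmult n (f a)"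
  by (induction n) (simp_all add: mv_hom_def)

lemma mv_hom_congr: "mv_hom f \<Longrightarrow> f ` I \<subseteq> J \<Longrightarrow> congr I x y \<Longrightarrow> congr J (f x) (f y)"
  unfolding congr_def by (metis mv_hom_monus image_subset_iff)

lemma mv_hom_adjoin:
  assumes "mv_hom f" "f ` I \<subseteq> J" shows "f ` adjoin a I \<subseteq> adjoin (f a) J"
proof clarify
  fix x assume "x \<in> adjoin a I"
  then obtain i n where i: "i \<in> I" "x \<sqsubseteq> i + nmult n a" unfolding adjoin_def by blast
  then have "f x \<sqsubseteq> f i + nmult n (f a)"
    using mv_hom_below[OF assms(1) i(2)] mv_hom_nmult[OF assms(1)] assms(1) by (simp add: mv_hom_def)
  then show "f x \<in> adjoin (f a) J" using i assms(2) unfolding adjoin_def by blast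
qed

lemma covered_image:
  assumes "covered P I" "mv_hom f" "ideal I" "ideal J" "f ` I \<subseteq> J"
    and "\<And>I' J'. ideal I' \<Longrightarrow> ideal J' \<Longrightarrow> I \<subseteq> I' \<Longrightarrow> J \<subseteq> J' \<Longrightarrow> f ` I' \<subseteq> J' \<Longrightarrow> P I' \<Longrightarrow> Q J'"
  shows "covered Q J"
  using assms(1,3-)
proof (induction arbitrary: J)
  case (leaf I) then show ?case by (auto intro: covered.leaf)
next
  case (improper I)
  have "f (- 0) = - 0" using assms(2) by (simp add: mv_hom_def)
  with improper show ?case by (metis covered.improper image_subset_iff)
next
  case (split a b I)
  have "covered Q (adjoin (f x \<ominus> f y) J)" if xy: "(x, y) \<in> {(a, b), (b, a)}" for x y
  proof -
    have sub: "f ` adjoin (x \<ominus> y) I \<subseteq> adjoin (f x \<ominus> f y) J"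
      using mv_hom_adjoin[OF assms(2) split.prems(3)] mv_hom_monus[OF assms(2)] by metis
    note * = ideal_adjoin[OF split.prems(1)] ideal_adjoin[OF split.prems(2)] sub
    from xy show ?thesis
    proof (elim insertE emptyE Pair_inject; hypsubst)
      show "covered Q (adjoin (f a \<ominus> f b) J)" if "x = a" "y = b"
        using * that by (intro split.IH(1)) (auto intro!: split.prems(4) dest: subset_adjoin[THEN subsetD])
      show "covered Q (adjoin (f b \<ominus> f a) J)" if "x = b" "y = a"
        using * that by (intro split.IH(2)) (auto intro!: split.prems(4) dest: subset_adjoin[THEN subsetD])
    qed
  qed
  then show ?case by (auto intro: covered.split)
qed


lemma covered_mono:
  assumes "covered P I" "ideal I" "\<And>J. ideal J \<Longrightarrow> I \<subseteq> J \<Longrightarrow> P J \<Longrightarrow> Q J"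
  shows "covered Q I"
  using assms
proof induction
  case (split a b I)
  have "covered Q (adjoin (a \<ominus> b) I)"
    using split.prems by (intro split.IH(1) ideal_adjoin) (blast dest: subset_adjoin[THEN subsetD])+
  moreover have "covered Q (adjoin (b \<ominus> a) I)"
    using split.prems by (intro split.IH(2) ideal_adjoin) (blast dest: subset_adjoin[THEN subsetD])+
  ultimately show ?case by (rule covered.split)
qed (auto intro: covered.leaf covered.improper)

lemma covered_covered: "covered (covered P) I \<Longrightarrow> covered P I"
  by (induction rule: covered.induct) (auto intro: covered.improper covered.split)

lemma covered_mem:
  assumes "covered (\<lambda>J. x \<in> J) I" "ideal I"
  shows "x \<in> I"
  using assms
proof induction
  case (improper I) then show ?case using ideal_below below_one by blast
next
  case (split a b I)
  then show ?case
    by (intro adjoin_disjoint[OF \<open>ideal I\<close> disjoint_monus]) (auto intro: ideal_adjoin)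
qed

lemma covered_congr:
  assumes "covered (\<lambda>J. congr J x y) I" "ideal I"
  shows "congr I x y"
  unfolding congr_def
  using covered_mem covered_mono[OF assms] assms(2) unfolding congr_def by blast

text \<open>
  Gluing along a whole covering tree, for witnesses that are unique up to congruence. On the two
  branches of a split the witnesses agree modulo the sum of the two ideals by uniqueness, hence glue
  by \<open>glue_two\<close>; locality of \<open>Q\<close> carries the glued witness down to \<open>I\<close>.
\<close>

lemma glue:
  assumes "covered (\<lambda>J. \<exists>x. Q J x) I" and "ideal I"
    and mono: "\<And>J J' x. ideal J \<Longrightarrow> ideal J' \<Longrightarrow> J \<subseteq> J' \<Longrightarrow> Q J x \<Longrightarrow> Q J' x"
    and cong: "\<And>J x y. ideal J \<Longrightarrow> Q J x \<Longrightarrow> congr J x y \<Longrightarrow> Q J y"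
    and uniq: "\<And>J x y. ideal J \<Longrightarrow> Q J x \<Longrightarrow> Q J y \<Longrightarrow> congr J x y"
    and local: "\<And>J x. ideal J \<Longrightarrow> covered (\<lambda>J'. Q J' x) J \<Longrightarrow> Q J x"
  shows "\<exists>x. Q I x"
  using assms(1,2)
proof induction
  case (leaf I) then show ?case by blast
next
  case (improper I) then show ?case by (blast intro: local covered.improper)
next
  case (split a b I)
  let ?u = "a \<ominus> b" and ?v = "b \<ominus> a"
  let ?J = "adjoin ?v (adjoin ?u I)"
  note ideals = ideal_adjoin[OF \<open>ideal I\<close>, of ?u] ideal_adjoin[OF \<open>ideal I\<close>, of ?v]
    ideal_adjoin[OF ideal_adjoin[OF \<open>ideal I\<close>, of ?u], of ?v]
  obtain s t where s: "Q (adjoin ?u I) s" and t: "Q (adjoin ?v I) t"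
    using split.IH ideals by blast
  have "adjoin ?v I \<subseteq> ?J"
    using ideals by (intro adjoin_least subset_trans[OF subset_adjoin subset_adjoin] mem_adjoin)
  then have "Q ?J t" using mono[OF ideals(2,3)] t by blast
  moreover have "Q ?J s" using mono[OF ideals(1,3) subset_adjoin s] .
  ultimately have "congr ?J s t" using uniq[OF ideals(3)] by blast
  then obtain r where "congr (adjoin ?u I) r s" "congr (adjoin ?v I) r t"
    using glue_two[OF \<open>ideal I\<close>] by blast
  then have "Q (adjoin ?u I) r" "Q (adjoin ?v I) r"
    using cong ideals s t congr_sym by blast+
  then have "covered (\<lambda>J. Q J r) I" by (blast intro: covered.leaf covered.split)
  then show ?case using local \<open>ideal I\<close> by blast
qed

section \<open>Forcing over the ideals of an MV-algebra\<close>

primrec eval :: "(nat \<Rightarrow> 'a::mv_algebra) \<Rightarrow> tm \<Rightarrow> 'a" where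
  "eval s (Var i) = s i"
| "eval s Zero = 0"
| "eval s (Neg t) = - eval s t"
| "eval s (Plus t u) = eval s t + eval s u"

primrec forces :: "'i fm \<Rightarrow> 'a::mv_algebra set \<Rightarrow> (nat \<Rightarrow> 'a) \<Rightarrow> bool" where
  "forces (Eq t u) I s \<longleftrightarrow> congr I (eval s t) (eval s u)"
| "forces Top I s \<longleftrightarrow> True"
| "forces (And \<phi> \<psi>) I s \<longleftrightarrow> forces \<phi> I s \<and> forces \<psi> I s"
| "forces (Ex \<phi>) I s \<longleftrightarrow> covered (\<lambda>J. \<exists>x. forces \<phi> J (case_nat x s)) I"
| "forces (Disj K F) I s \<longleftrightarrow> covered (\<lambda>J. \<exists>k\<in>K. forces (F k) J s) I"

lemma eval_hom: "mv_hom f \<Longrightarrow> eval (\<lambda>i. f (s i)) t = f (eval s t)"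
  by (induction t) (simp_all add: mv_hom_def)

lemma eval_congr: "ideal I \<Longrightarrow> (\<And>i. congr I (s i) (s' i)) \<Longrightarrow> congr I (eval s t) (eval s' t)"
  by (induction t) (auto intro: congr_refl congr_neg congr_add)

lemma eval_subst: "eval s (subst_tm \<sigma> t) = eval (\<lambda>i. eval s (\<sigma> i)) t"
  by (induction t) simp_all

lemma eval_lift_subst:
  "eval (case_nat x s) (lift_subst \<sigma> i) = case_nat x (\<lambda>i. eval s (\<sigma> i)) i"
  by (simp add: lift_subst_def eval_subst shift_def split: nat.split)

lemma forces_subst: "forces (subst_fm \<sigma> \<phi>) I s \<longleftrightarrow> forces \<phi> I (\<lambda>i. eval s (\<sigma> i))"
  by (induction \<phi> arbitrary: \<sigma> I s) (simp_all add: eval_subst eval_lift_subst)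

lemma forces_shift: "forces (subst_fm shift \<phi>) I (case_nat x s) \<longleftrightarrow> forces \<phi> I s"
  by (simp add: forces_subst shift_def)

text \<open>
  With the identity this is persistence of forcing along larger ideals; with a substitution
  homomorphism between free algebras it moves forcing from one context to another.
\<close>

lemma forces_image:
  assumes "forces \<phi> I s" "mv_hom f" "ideal I" "ideal J" "f ` I \<subseteq> J"
  shows "forces \<phi> J (\<lambda>i. f (s i))"
  using assms(1,3-)
proof (induction \<phi> arbitrary: I J s)
  case (Eq t u)
  then show ?case using mv_hom_congr[OF assms(2)] by (simp add: eval_hom[OF assms(2)])
next
  case (Ex \<phi>)
  have *: "case_nat (f x) (\<lambda>i. f (s i)) = (\<lambda>i. f (case_nat x s i))" for x
    by (auto split: nat.split)
  from Ex.prems(1) have "covered (\<lambda>J. \<exists>x. forces \<phi> J (case_nat x s)) I" by simp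
  then have "covered (\<lambda>J. \<exists>x. forces \<phi> J (case_nat x (\<lambda>i. f (s i)))) J"
  proof (rule covered_image[OF _ assms(2) Ex.prems(2-)])
    fix I' J'
    assume IJ: "ideal I'" "ideal J'" "f ` I' \<subseteq> J'" and "\<exists>x. forces \<phi> I' (case_nat x s)"
    then obtain x where "forces \<phi> I' (case_nat x s)" by blast
    from Ex.IH[OF this IJ] show "\<exists>x. forces \<phi> J' (case_nat x (\<lambda>i. f (s i)))"
      unfolding *[symmetric] ..
  qed
  then show ?case by simp
next
  case (Disj K F)
  from Disj.prems(1) have "covered (\<lambda>J. \<exists>k\<in>K. forces (F k) J s) I" by simp
  then have "covered (\<lambda>J. \<exists>k\<in>K. forces (F k) J (\<lambda>i. f (s i))) J"
    by (rule covered_image[OF _ assms(2) Disj.prems(2-)]) (blast intro: Disj.IH)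
  then show ?case by simp
qed auto

lemma forces_mono:
  assumes "forces \<phi> I s" "ideal I" "ideal J" "I \<subseteq> J"
  shows "forces \<phi> J s"
proof -
  have "mv_hom (\<lambda>x :: 'b. x)" by (simp add: mv_hom_def)
  then show ?thesis using forces_image[OF assms(1) _ assms(2,3)] assms(4) by auto
qed

lemma forces_congr:
  assumes "forces \<phi> I s" "ideal I" "\<And>i. congr I (s i) (s' i)"
  shows "forces \<phi> I s'"
  using assms
proof (induction \<phi> arbitrary: I s s')
  case (Eq t u)
  then show ?case using eval_congr[of I s s'] 
    by simp (meson congr_sym congr_trans)
next
  case (Ex \<phi>)
  from Ex.prems(1) have "covered (\<lambda>J. \<exists>x. forces \<phi> J (case_nat x s)) I" by simp
  then have "covered (\<lambda>J. \<exists>x. forces \<phi> J (case_nat x s')) I"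
  proof (rule covered_mono[OF _ Ex.prems(2)])
    fix J assume J: "ideal J" "I \<subseteq> J" and "\<exists>x. forces \<phi> J (case_nat x s)"
    then obtain x where x: "forces \<phi> J (case_nat x s)" by blast
    have "forces \<phi> J (case_nat x s')"
      by (rule Ex.IH[OF x J(1)])
        (use J Ex.prems(3) in \<open>auto intro: congr_refl congr_subset split: nat.split\<close>)
    then show "\<exists>x. forces \<phi> J (case_nat x s')" ..
  qed
  then show ?case by simp
next
  case (Disj K F)
  from Disj.prems(1) have "covered (\<lambda>J. \<exists>k\<in>K. forces (F k) J s) I" by simp
  then have "covered (\<lambda>J. \<exists>k\<in>K. forces (F k) J s') I"
  proof (rule covered_mono[OF _ Disj.prems(2)])
    fix J assume J: "ideal J" "I \<subseteq> J" and "\<exists>k\<in>K. forces (F k) J s"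
    moreover have "congr J (s i) (s' i)" for i
      using Disj.prems(3) J(2) by (rule congr_subset)
    ultimately show "\<exists>k\<in>K. forces (F k) J s'" by (blast intro: Disj.IH)
  qed
  then show ?case by simp
qed auto

lemma forces_local:
  assumes "covered (\<lambda>J. forces \<phi> J s) I" "ideal I"
  shows "forces \<phi> I s"
  using assms
proof (induction \<phi> arbitrary: I s)
  case (And \<phi> \<psi>)
  then show ?case by (auto intro!: And.IH elim: covered_mono)
qed (auto intro: covered_congr covered_covered)

primrec holds_in :: "'a::mv_algebra set \<Rightarrow> 'i seq \<Rightarrow> bool" where
  "holds_in I (Seq n \<phi> \<psi>) \<longleftrightarrow> (\<forall>s. forces \<phi> I s \<longrightarrow> forces \<psi> I s)"

text \<open>
  The elimination rules for disjunction and existence rest on locality; the rules of distributivity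
  and Frobenius rest on persistence.
\<close>

theorem soundness:
  assumes "T \<turnstile> \<sigma>" and T: "\<And>\<sigma> I. \<sigma> \<in> T \<Longrightarrow> ideal (I :: 'a::mv_algebra set) \<Longrightarrow> holds_in I \<sigma>"
    and "ideal (I :: 'a set)"
  shows "holds_in I \<sigma>"
  using assms(1,3)
proof (induction arbitrary: I)
  case (ax \<sigma>) then show ?case by (intro T)
next
  case (subst n \<phi> \<psi> m s) then show ?case by (simp add: forces_subst)
next
  case (eq_refl i n) then show ?case by (simp add: congr_refl)
next
  case (eq_subst i n j \<phi>)
  show ?case
    unfolding holds_in.simps forces_subst forces.simps
  proof (intro allI impI)
    fix s :: "nat \<Rightarrow> 'a" assume s: "congr I (eval s (Var i)) (eval s (Var j)) \<and> forces \<phi> I s"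
    show "forces \<phi> I (\<lambda>k. eval s ((Var(i := Var j)) k))"
      by (rule forces_congr[of \<phi> I s]) (use s eq_subst in \<open>auto intro: congr_refl\<close>)
  qed
next
  case (disj_intro n K F k)
  then show ?case by (auto intro: covered.leaf)
next
  case (disj_elim n \<chi> K F)
  show ?case
    unfolding holds_in.simps forces.simps
  proof (intro allI impI)
    fix s :: "nat \<Rightarrow> 'a" assume "covered (\<lambda>J. \<exists>k\<in>K. forces (F k) J s) I"
    then have "covered (\<lambda>J. forces \<chi> J s) I"
      by (rule covered_mono[OF _ disj_elim.prems]) (use disj_elim.IH in auto)
    then show "forces \<chi> I s" using disj_elim.prems by (rule forces_local)
  qed
next
  case (ex_elim n \<psi> \<phi>)
  show ?case
    unfolding holds_in.simps forces.simps
  proof (intro allI impI)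
    fix s :: "nat \<Rightarrow> 'a" assume "covered (\<lambda>J. \<exists>x. forces \<phi> J (case_nat x s)) I"
    then have "covered (\<lambda>J. forces \<psi> J s) I"
    proof (rule covered_mono[OF _ ex_elim.prems])
      fix J assume J: "ideal J" and "\<exists>x. forces \<phi> J (case_nat x s)"
      then obtain x where "forces \<phi> J (case_nat x s)" by blast
      with ex_elim.IH[OF J] show "forces \<psi> J s"
        by (auto simp: forces_shift dest: spec[of _ "case_nat x s"])
    qed
    then show "forces \<psi> I s" using ex_elim.prems by (rule forces_local)
  qed
next
  case (ex_intro n \<phi> \<psi>)
  show ?case
    unfolding holds_in.simps
  proof (intro allI impI)
    fix s :: "nat \<Rightarrow> 'a" assume s: "forces \<phi> I s"
    have eq: "s = case_nat (s 0) (\<lambda>i. s (Suc i))" by (auto split: nat.split)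
    have "forces (Ex \<phi>) I (\<lambda>i. s (Suc i))"
      unfolding forces.simps by (intro covered.leaf exI[of _ "s 0"]) (use s eq in metis)
    then have "forces \<psi> I (\<lambda>i. s (Suc i))" using ex_intro by simp
    then show "forces (subst_fm shift \<psi>) I s" by (simp add: forces_subst shift_def)
  qed
next
  case (distrib n \<phi> K F)
  then show ?case
    by (auto elim!: covered_mono intro: forces_mono)
next
  case (frobenius n \<phi> \<psi>)
  then show ?case
    by (auto elim!: covered_mono simp: forces_shift intro: forces_mono)
qed auto

lemma forces_NDisj: "forces (NDisj K F) I s \<longleftrightarrow> covered (\<lambda>J. \<exists>k\<in>K. forces (F k) J s) I"
  by (simp add: NDisj_def)

lemma forces_Or: "forces \<phi> I s \<or> forces \<psi> I s \<Longrightarrow> forces (Or \<phi> \<psi>) I s"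
  unfolding Or_def forces_NDisj by (intro covered.leaf) auto

lemma congr_one_iff: "ideal I \<Longrightarrow> congr I x (- 0) \<longleftrightarrow> - x \<in> I"
  using below_one[of x] unfolding below_def by (simp add: congr_def ideal_zero monus_def)

lemma MV_holds_in:
  assumes "\<sigma> \<in> MV" "ideal (I :: 'a::mv_algebra set)"
  shows "holds_in I \<sigma>"
proof -
  have eq: "holds_in I (Seq n Top (Eq t u))"
    if "\<And>s :: nat \<Rightarrow> 'a. eval s t = eval s u" for n t u
    using that assms(2) by (simp add: congr_refl)
  show ?thesis
    using assms(1) unfolding MV_def Let_def
    by (elim insertE emptyE; hypsubst; intro eq)
      (simp_all add: add.assoc lukasiewicz, rule add.commute)
qed

lemma Loc_holds_in:
  assumes "\<sigma> \<in> Loc" "ideal (I :: 'a::mv_algebra set)"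
  shows "holds_in I \<sigma>"
proof -
  have local: "holds_in I (Seq 1 Top (NDisj {1..} (\<lambda>k. Or (Eq (times_tm k (Var 0)) One)
                                       (Eq (times_tm k (Neg (Var 0))) One))))"
    unfolding holds_in.simps
  proof (intro allI impI)
    fix s :: "nat \<Rightarrow> 'a"
    let ?F = "\<lambda>k. Or (Eq (times_tm k (Var 0)) One) (Eq (times_tm k (Neg (Var 0))) One)"
    let ?x = "s 0"
    \<comment> \<open>The disjunct for \<open>k = 2\<close> is always enough, since prime quotients are linearly ordered:
      \<open>2 x = 1\<close> holds as soon as \<open>- x \<le> x\<close>.\<close>
    have two: "forces (?F 2) J s" if "ideal J" "- (?x + ?x) \<in> J \<or> - (- ?x + - ?x) \<in> J" for J
      by (rule forces_Or) (use that in \<open>simp add: numeral_2_eq_2 congr_one_iff\<close>)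
    have "forces (?F 2) (adjoin (- ?x \<ominus> ?x) I) s"
      using mem_adjoin[OF assms(2), of "- ?x \<ominus> ?x"]
      by (intro two ideal_adjoin assms(2)) (simp add: monus_def)
    moreover have "forces (?F 2) (adjoin (?x \<ominus> - ?x) I) s"
      using mem_adjoin[OF assms(2), of "?x \<ominus> - ?x"]
      by (intro two ideal_adjoin assms(2)) (simp add: monus_def)
    moreover have "(2::nat) \<in> {1..}" by simp
    ultimately show "forces (NDisj {1..} ?F) I s"
      unfolding forces_NDisj by (blast intro: covered.leaf covered.split)
  qed
  have nontrivial: "holds_in I (Seq 0 (Eq Zero One) Bot)"
    using assms(2) by (auto simp: Bot_def forces_NDisj congr_one_iff intro: covered.improper)
  show ?thesis
    using assms local nontrivial MV_holds_in unfolding Loc_def by blast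
qed
section \<open>Substitution and derived rules of geometric logic\<close>

lemma subst_tm_comp: "subst_tm \<sigma> (subst_tm \<tau> t) = subst_tm (\<lambda>i. subst_tm \<sigma> (\<tau> i)) t"
  by (induction t) simp_all

lemma subst_tm_Var [simp]: "subst_tm Var t = t"
  by (induction t) simp_all

lemma lift_subst_comp:
  "subst_tm (lift_subst \<sigma>) (lift_subst \<tau> i) = lift_subst (\<lambda>i. subst_tm \<sigma> (\<tau> i)) i"
  by (simp add: lift_subst_def subst_tm_comp shift_def split: nat.split)

lemma lift_subst_Var [simp]: "lift_subst Var = Var"
  by (rule ext) (simp add: lift_subst_def shift_def split: nat.split)

lemma subst_fm_comp: "subst_fm \<sigma> (subst_fm \<tau> \<phi>) = subst_fm (\<lambda>i. subst_tm \<sigma> (\<tau> i)) \<phi>"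
  by (induction \<phi> arbitrary: \<sigma> \<tau>) (simp_all add: subst_tm_comp lift_subst_comp)

lemma subst_fm_Var [simp]: "subst_fm Var \<phi> = \<phi>"
  by (induction \<phi>) simp_all

lemma subst_tm_shift [simp]: "subst_tm \<sigma> (subst_tm shift t) = subst_tm (\<lambda>i. \<sigma> (Suc i)) t"
  by (simp add: subst_tm_comp shift_def)

lemma subst_fm_shift: "subst_fm \<sigma> (subst_fm shift \<phi>) = subst_fm (\<lambda>i. \<sigma> (Suc i)) \<phi>"
  by (simp add: subst_fm_comp shift_def)

lemma subst_fm_instantiate_lift:
  "subst_fm (case_nat t Var) (subst_fm (lift_subst \<sigma>) \<phi>) = subst_fm (case_nat t \<sigma>) \<phi>"
proof -
  have "(\<lambda>i. subst_tm (case_nat t Var) (lift_subst \<sigma> i)) = case_nat t \<sigma>"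
    by (rule ext) (simp add: lift_subst_def split: nat.split)
  then show ?thesis by (simp add: subst_fm_comp)
qed

lemma wf_subst_tm: "wf_tm n t \<Longrightarrow> (\<And>i. i < n \<Longrightarrow> wf_tm m (\<sigma> i)) \<Longrightarrow> wf_tm m (subst_tm \<sigma> t)"
  by (induction t) simp_all

lemma wf_shift_tm: "wf_tm n t \<Longrightarrow> wf_tm (Suc n) (subst_tm shift t)"
  by (erule wf_subst_tm) (simp add: shift_def)

lemma wf_lift_subst:
  "(\<And>i. i < n \<Longrightarrow> wf_tm m (\<sigma> i)) \<Longrightarrow> i < Suc n \<Longrightarrow> wf_tm (Suc m) (lift_subst \<sigma> i)"
  by (auto simp: lift_subst_def wf_shift_tm split: nat.split)

lemma wf_subst_fm: "wf_fm n \<phi> \<Longrightarrow> (\<And>i. i < n \<Longrightarrow> wf_tm m (\<sigma> i)) \<Longrightarrow> wf_fm m (subst_fm \<sigma> \<phi>)"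
proof (induction \<phi> arbitrary: n m \<sigma>)
  case (Ex \<phi>)
  have "wf_fm (Suc m) (subst_fm (lift_subst \<sigma>) \<phi>)"
  proof (rule Ex.IH)
    show "wf_fm (Suc n) \<phi>" using Ex.prems(1) by simp
    show "wf_tm (Suc m) (lift_subst \<sigma> i)" if "i < Suc n" for i
      using Ex.prems(2) that by (rule wf_lift_subst)
  qed
  then show ?case by simp
qed (auto intro: wf_subst_tm)

lemma wf_shift_fm: "wf_fm n \<phi> \<Longrightarrow> wf_fm (Suc n) (subst_fm shift \<phi>)"
  by (erule wf_subst_fm) (simp add: shift_def)

lemma subst_tm_cong: "wf_tm n t \<Longrightarrow> (\<And>i. i < n \<Longrightarrow> \<sigma> i = \<tau> i) \<Longrightarrow> subst_tm \<sigma> t = subst_tm \<tau> t"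
  by (induction t) simp_all

lemma derivable_eq_refl:
  assumes "wf_fm m \<theta>" "wf_tm m t"
  shows "T \<turnstile> Seq m \<theta> (Eq t t)"
proof -
  have "T \<turnstile> Seq m (subst_fm (\<lambda>_. t) Top) (subst_fm (\<lambda>_. t) (Eq (Var 0) (Var 0)))"
    by (rule derivable.subst[OF derivable.eq_refl[of 0 1]]) (simp_all add: assms)
  then show ?thesis using derivable.cut[OF derivable.top[OF assms(1)]] by simp
qed

text \<open>
  The equality rule of the calculus replaces one variable by another. Replacing terms is obtained by
  giving \<open>\<phi>\<close> a second fresh variable, applying the rule to the two fresh variables, and
  substituting \<open>t\<close> and \<open>u\<close> for them.
\<close>

lemma derivable_leibniz:
  assumes eq: "T \<turnstile> Seq m \<theta> (Eq t u)" and t: "T \<turnstile> Seq m \<theta> (subst_fm (case_nat t Var) \<phi>)"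
    and wf: "wf_fm (Suc m) \<phi>" "wf_tm m t" "wf_tm m u"
  shows "T \<turnstile> Seq m \<theta> (subst_fm (case_nat u Var) \<phi>)"
proof -
  define \<psi> where "\<psi> = subst_fm (case_nat (Var 0) (\<lambda>j. Var (j + 2))) \<phi>"
  define \<sigma> where "\<sigma> = case_nat t (case_nat u Var)"
  have "wf_fm (m + 2) \<psi>"
    unfolding \<psi>_def by (rule wf_subst_fm[OF wf(1)]) (auto split: nat.split)
  then have "T \<turnstile> Seq (m + 2) (And (Eq (Var 0) (Var 1)) \<psi>) (subst_fm (Var(0 := Var 1)) \<psi>)"
    by (intro derivable.eq_subst) auto
  then have *: "T \<turnstile> Seq m (subst_fm \<sigma> (And (Eq (Var 0) (Var 1)) \<psi>)) (subst_fm \<sigma> (subst_fm (Var(0 := Var 1)) \<psi>))"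
    by (rule derivable.subst) (use wf in \<open>auto simp: \<sigma>_def split: nat.split\<close>)
  have "subst_fm \<sigma> \<psi> = subst_fm (case_nat t Var) \<phi>"
    unfolding \<psi>_def subst_fm_comp
    by (rule arg_cong[where f = "\<lambda>s. subst_fm s \<phi>"]) (auto simp: \<sigma>_def split: nat.split)
  moreover have "subst_fm \<sigma> (subst_fm (Var(0 := Var 1)) \<psi>) = subst_fm (case_nat u Var) \<phi>"
    unfolding \<psi>_def subst_fm_comp
    by (rule arg_cong[where f = "\<lambda>s. subst_fm s \<phi>"]) (auto simp: \<sigma>_def split: nat.split)
  ultimately have "T \<turnstile> Seq m (And (Eq t u) (subst_fm (case_nat t Var) \<phi>)) (subst_fm (case_nat u Var) \<phi>)"
    using * by (simp add: \<sigma>_def)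
  then show ?thesis using derivable.cut derivable.and_intro[OF eq t] by blast
qed

lemma derivable_eq_sym:
  assumes "T \<turnstile> Seq m \<theta> (Eq t u)" "wf_fm m \<theta>" "wf_tm m t" "wf_tm m u"
  shows "T \<turnstile> Seq m \<theta> (Eq u t)"
  using derivable_leibniz[OF assms(1), of "Eq (Var 0) (subst_tm shift t)"] assms
  by (simp add: derivable_eq_refl wf_shift_tm)

lemma derivable_eq_trans:
  assumes "T \<turnstile> Seq m \<theta> (Eq t u)" "T \<turnstile> Seq m \<theta> (Eq u v)" "wf_tm m t" "wf_tm m u" "wf_tm m v"
  shows "T \<turnstile> Seq m \<theta> (Eq t v)"
  using derivable_leibniz[OF assms(2), of "Eq (subst_tm shift t) (Var 0)"] assms
  by (simp add: wf_shift_tm)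

lemma derivable_eq_Neg:
  assumes "T \<turnstile> Seq m \<theta> (Eq t u)" "wf_fm m \<theta>" "wf_tm m t" "wf_tm m u"
  shows "T \<turnstile> Seq m \<theta> (Eq (Neg t) (Neg u))"
  using derivable_leibniz[OF assms(1), of "Eq (Neg (subst_tm shift t)) (Neg (Var 0))"] assms
  by (simp add: derivable_eq_refl wf_shift_tm)

lemma derivable_eq_Plus:
  assumes "T \<turnstile> Seq m \<theta> (Eq t t')" "T \<turnstile> Seq m \<theta> (Eq u u')" "wf_fm m \<theta>"
    "wf_tm m t" "wf_tm m t'" "wf_tm m u" "wf_tm m u'"
  shows "T \<turnstile> Seq m \<theta> (Eq (Plus t u) (Plus t' u'))"
proof -
  have "T \<turnstile> Seq m \<theta> (Eq (Plus t u) (Plus t' u))"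
    using derivable_leibniz[OF assms(1), of "Eq (subst_tm shift (Plus t u)) (Plus (Var 0) (subst_tm shift u))"] assms
    by (simp add: derivable_eq_refl wf_shift_tm)
  moreover have "T \<turnstile> Seq m \<theta> (Eq (Plus t' u) (Plus t' u'))"
    using derivable_leibniz[OF assms(2), of "Eq (subst_tm shift (Plus t' u)) (Plus (subst_tm shift t') (Var 0))"] assms
    by (simp add: derivable_eq_refl wf_shift_tm)
  ultimately show ?thesis by (rule derivable_eq_trans) (use assms in simp_all)
qed

lemma derivable_axiom_instance:
  assumes "Seq n Top (Eq t u) \<in> T" "wf_tm n t" "wf_tm n u"
    and "wf_fm m \<theta>" "\<And>i. i < n \<Longrightarrow> wf_tm m (\<sigma> i)"
  shows "T \<turnstile> Seq m \<theta> (Eq (subst_tm \<sigma> t) (subst_tm \<sigma> u))"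
proof -
  have "T \<turnstile> Seq m (subst_fm \<sigma> Top) (subst_fm \<sigma> (Eq t u))"
    by (rule derivable.subst[of _ n]) (use assms in \<open>auto intro: derivable.ax\<close>)
  then show ?thesis using derivable.cut[OF derivable.top[OF assms(4)]] by simp
qed

lemma derivable_Ex_witness:
  assumes "T \<turnstile> Seq m \<theta> (subst_fm (case_nat t \<sigma>) \<phi>)" "wf_tm m t" "wf_fm m (subst_fm \<sigma> (Ex \<phi>))"
  shows "T \<turnstile> Seq m \<theta> (subst_fm \<sigma> (Ex \<phi>))"
proof -
  let ?\<psi> = "subst_fm (lift_subst \<sigma>) \<phi>"
  have "T \<turnstile> Seq (Suc m) ?\<psi> (subst_fm shift (Ex ?\<psi>))"
    using assms(3) by (intro derivable.ex_intro derivable.ident) simp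
  then have "T \<turnstile> Seq m (subst_fm (case_nat t Var) ?\<psi>) (subst_fm (case_nat t Var) (subst_fm shift (Ex ?\<psi>)))"
    by (rule derivable.subst) (use assms(2) in \<open>auto split: nat.split\<close>)
  moreover have "subst_fm (case_nat t Var) (subst_fm shift (Ex ?\<psi>)) = subst_fm \<sigma> (Ex \<phi>)"
    unfolding subst_fm_shift by simp
  ultimately show ?thesis
    using derivable.cut[OF assms(1)] by (simp only: subst_fm_instantiate_lift)
qed

lemma derivable_Ex_left:
  assumes "T \<turnstile> Seq (Suc m) (And (subst_fm shift \<theta>) \<psi>) (subst_fm shift \<chi>)"
    and "wf_fm m \<theta>" "wf_fm (Suc m) \<psi>" "wf_fm m \<chi>"
  shows "T \<turnstile> Seq m (And \<theta> (Ex \<psi>)) \<chi>"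
  using assms by (intro derivable.cut[OF derivable.frobenius derivable.ex_elim]) simp_all

lemma derivable_transfer:
  assumes "T \<turnstile> \<sigma>" "\<And>\<tau>. \<tau> \<in> T \<Longrightarrow> wf_seq \<tau> \<Longrightarrow> U \<turnstile> \<tau>"
  shows "U \<turnstile> \<sigma>"
  using assms(1)
proof induction
  case ax
  then show ?case by (rule assms(2))
next
  case subst
  from subst.IH subst.hyps(2) show ?case by (rule derivable.subst)
next
  case cut
  from cut.IH show ?case by (rule derivable.cut)
next
  case and_intro
  from and_intro.IH show ?case by (rule derivable.and_intro)
next
  case disj_elim
  from disj_elim.hyps(1) disj_elim.IH show ?case by (rule derivable.disj_elim)
next
  case ex_elim
  from ex_elim.hyps(1) ex_elim.IH show ?case by (rule derivable.ex_elim)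
next
  case ex_intro
  from ex_intro.IH show ?case by (rule derivable.ex_intro)
next
  case ident
  then show ?case by (rule derivable.ident)
next
  case eq_refl
  then show ?case by (rule derivable.eq_refl)
next
  case eq_subst
  then show ?case by (rule derivable.eq_subst)
next
  case top
  then show ?case by (rule derivable.top)
next
  case and_left
  then show ?case by (rule derivable.and_left)
next
  case and_right
  then show ?case by (rule derivable.and_right)
next
  case disj_intro
  then show ?case by (rule derivable.disj_intro)
next
  case distrib
  then show ?case by (rule derivable.distrib)
next
  case frobenius
  then show ?case by (rule derivable.frobenius)
qed
section \<open>The free MV-algebra\<close>

inductive mv_eq :: "tm \<Rightarrow> tm \<Rightarrow> bool" where
  refl: "mv_eq t t"
| sym: "mv_eq t u \<Longrightarrow> mv_eq u t"
| trans: "mv_eq t u \<Longrightarrow> mv_eq u v \<Longrightarrow> mv_eq t v"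
| Neg: "mv_eq t u \<Longrightarrow> mv_eq (Neg t) (Neg u)"
| Plus: "mv_eq t t' \<Longrightarrow> mv_eq u u' \<Longrightarrow> mv_eq (Plus t u) (Plus t' u')"
| assoc: "mv_eq (Plus t (Plus u v)) (Plus (Plus t u) v)"
| commute: "mv_eq (Plus t u) (Plus u t)"
| zero: "mv_eq (Plus t Zero) t"
| neg_neg: "mv_eq (Neg (Neg t)) t"
| one: "mv_eq (Plus t One) One"
| lukasiewicz: "mv_eq (Plus (Neg (Plus (Neg t) u)) u) (Plus (Neg (Plus (Neg u) t)) t)"

lemma mv_eq_subst: "mv_eq t u \<Longrightarrow> mv_eq (subst_tm \<sigma> t) (subst_tm \<sigma> u)"
  by (induction rule: mv_eq.induct) (simp_all, (blast intro: mv_eq.intros)+)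

text \<open>
  Equational reasoning with the axioms of MV-algebras is available in the sequent calculus under any
  antecedent.
\<close>

lemma derivable_mv_eq:
  assumes "mv_eq t u" "wf_fm m \<theta>" "\<And>i. wf_tm m (\<sigma> i)"
  shows "MV \<turnstile> Seq m \<theta> (Eq (subst_tm \<sigma> t) (subst_tm \<sigma> u))"
proof -
  have wf: "wf_tm m (subst_tm \<sigma> t)" for t
    by (induction t) (simp_all add: assms(3))
  note [simp] = wf[simplified] assms(3)
  define inst where "inst t u v = case_nat (subst_tm \<sigma> t) (case_nat (subst_tm \<sigma> u) (\<lambda>_. subst_tm \<sigma> v))"
    for t u v
  have inst: "inst t u v 0 = subst_tm \<sigma> t" "inst t u v (Suc 0) = subst_tm \<sigma> u"
    "inst t u v 2 = subst_tm \<sigma> v" "wf_tm m (inst t u v i)" for t u v i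
    by (simp_all add: inst_def wf numeral_2_eq_2 split: nat.split)
  have axiom: "MV \<turnstile> Seq m \<theta> (Eq (subst_tm (inst t u v) a) (subst_tm (inst t u v) b))"
    if "Seq n Top (Eq a b) \<in> (MV :: 'a seq set)" "wf_tm n a" "wf_tm n b" for a b n t u v
    using that by (rule derivable_axiom_instance) (simp_all add: assms(2) inst)
  note MV_axiom = MV_def Let_def
  from assms(1) show ?thesis
  proof induction
    case (refl t) then show ?case by (intro derivable_eq_refl assms(2) wf)
  next
    case (sym t u) then show ?case using assms(2) wf by (blast intro: derivable_eq_sym)
  next
    case (trans t u v) then show ?case using wf by (blast intro: derivable_eq_trans)
  next
    case (Neg t u)
    then show ?case using derivable_eq_Neg[OF Neg.IH assms(2) wf wf] by simp
  next
    case (Plus t t' u u')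
    then show ?case using derivable_eq_Plus[OF Plus.IH assms(2) wf wf wf wf] by simp
  next
    case (assoc t u v)
    show ?case using axiom[of 3 "Plus (Var 0) (Plus (Var 1) (Var 2))" "Plus (Plus (Var 0) (Var 1)) (Var 2)" t u v]
      by (simp add: MV_axiom inst)
  next
    case (commute t u)
    show ?case using axiom[of 2 "Plus (Var 0) (Var 1)" "Plus (Var 1) (Var 0)" t u]
      by (simp add: MV_axiom inst)
  next
    case (zero t)
    show ?case using axiom[of 1 "Plus (Var 0) Zero" "Var 0" t] by (simp add: MV_axiom inst)
  next
    case (neg_neg t)
    show ?case using axiom[of 1 "Neg (Neg (Var 0))" "Var 0" t] by (simp add: MV_axiom inst)
  next
    case (one t)
    show ?case using axiom[of 1 "Plus (Var 0) One" One t] by (simp add: MV_axiom inst)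
  next
    case (lukasiewicz t u)
    show ?case using axiom[of 2 "Plus (Neg (Plus (Neg (Var 0)) (Var 1))) (Var 1)"
        "Plus (Neg (Plus (Neg (Var 1)) (Var 0))) (Var 0)" t u]
      by (simp add: MV_axiom inst)
  qed
qed

quotient_type free_mv = tm / mv_eq
  by (intro equivpI reflpI sympI transpI) (blast intro: mv_eq.intros)+

instantiation free_mv :: mv_algebra
begin

lift_definition zero_free_mv :: free_mv is Zero .

lift_definition uminus_free_mv :: "free_mv \<Rightarrow> free_mv" is Neg
  by (rule mv_eq.Neg)

lift_definition plus_free_mv :: "free_mv \<Rightarrow> free_mv \<Rightarrow> free_mv" is Plus
  by (rule mv_eq.Plus)

instance
proof
  fix x y z :: free_mv
  show "(x + y) + z = x + (y + z)" by transfer (rule mv_eq.sym[OF mv_eq.assoc])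
  show "x + y = y + x" by transfer (rule mv_eq.commute)
  show "0 + x = x" by transfer (rule mv_eq.trans[OF mv_eq.commute mv_eq.zero])
  show "- (- x) = x" by transfer (rule mv_eq.neg_neg)
  show "x + - 0 = - 0" by transfer (rule mv_eq.one)
  show "- (- x + y) + y = - (- y + x) + x" by transfer (rule mv_eq.lukasiewicz)
qed

end

abbreviation cls :: "tm \<Rightarrow> free_mv" where
  "cls \<equiv> abs_free_mv"

lemma cls_surj: obtains t where "x = cls t"
  by (metis Quotient3_abs_rep Quotient3_free_mv)

lemma cls_eq_iff: "cls t = cls u \<longleftrightarrow> mv_eq t u"
  by (rule free_mv.abs_eq_iff)

lemma cls_simps: "cls Zero = 0" "cls (Neg t) = - cls t" "cls (Plus t u) = cls t + cls u"
  by (simp_all add: zero_free_mv_def uminus_free_mv.abs_eq plus_free_mv.abs_eq)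

lemma eval_cls: "eval (\<lambda>i. cls (\<sigma> i)) t = cls (subst_tm \<sigma> t)"
  by (induction t) (simp_all add: cls_simps)

lift_definition subst_free :: "(nat \<Rightarrow> tm) \<Rightarrow> free_mv \<Rightarrow> free_mv" is subst_tm
  by (rule mv_eq_subst)

lemma subst_free_cls: "subst_free \<sigma> (cls t) = cls (subst_tm \<sigma> t)"
  by (rule subst_free.abs_eq)

lemma mv_hom_subst_free: "mv_hom (subst_free \<sigma>)"
  unfolding mv_hom_def
proof (intro conjI allI)
  show "subst_free \<sigma> 0 = 0" by transfer (simp add: mv_eq.refl)
  show "subst_free \<sigma> (- x) = - subst_free \<sigma> x" for x by transfer (simp add: mv_eq.refl)
  show "subst_free \<sigma> (x + y) = subst_free \<sigma> x + subst_free \<sigma> y" for x y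
    by transfer (simp add: mv_eq.refl)
qed

section \<open>Formulae in context as ideals of the free MV-algebra\<close>

text \<open>
  The free algebra has all variables, a context of length \<open>m\<close> only the first \<open>m\<close>.
  Sending the remaining variables to zero turns every term into a term in context, so that a formula
  in context defines an ideal of the whole free algebra.
\<close>

definition clear :: "nat \<Rightarrow> nat \<Rightarrow> tm" where
  "clear m i = (if i < m then Var i else Zero)"

lemma wf_clear [simp]: "wf_tm m (clear m i)"
  by (simp add: clear_def)

lemma wf_subst_clear [simp]: "wf_tm m (subst_tm (clear m) t)"
  by (induction t) simp_all

lemma subst_clear: "wf_tm m t \<Longrightarrow> subst_tm (clear m) t = t"
  by (induction t) (simp_all add: clear_def)

definition formula_ideal :: "nat \<Rightarrow> 'i fm \<Rightarrow> free_mv set" where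
  "formula_ideal m \<theta> = {x. \<exists>t. x = cls t \<and> MV \<turnstile> Seq m \<theta> (Eq (subst_tm (clear m) t) Zero)}"

context
  fixes m :: nat and \<theta> :: "'i fm"
  assumes wf: "wf_fm m \<theta>"
begin

lemma formula_ideal_iff:
  "cls t \<in> formula_ideal m \<theta> \<longleftrightarrow> MV \<turnstile> Seq m \<theta> (Eq (subst_tm (clear m) t) Zero)"
proof
  assume "cls t \<in> formula_ideal m \<theta>"
  then obtain u where "mv_eq t u" "MV \<turnstile> Seq m \<theta> (Eq (subst_tm (clear m) u) Zero)"
    by (auto simp: formula_ideal_def cls_eq_iff)
  then show "MV \<turnstile> Seq m \<theta> (Eq (subst_tm (clear m) t) Zero)"
    using derivable_eq_trans[OF derivable_mv_eq[OF _ wf]] by simp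
qed (auto simp: formula_ideal_def)

lemma derivable_mv_eq_clear:
  "cls t = cls u \<Longrightarrow> MV \<turnstile> Seq m \<theta> (Eq (subst_tm (clear m) t) (subst_tm (clear m) u))"
  by (rule derivable_mv_eq[OF _ wf]) (simp_all add: cls_eq_iff)

lemma clear_eq_trans:
  assumes "MV \<turnstile> Seq m \<theta> (Eq (subst_tm (clear m) t) (subst_tm (clear m) u))"
    and "MV \<turnstile> Seq m \<theta> (Eq (subst_tm (clear m) u) (subst_tm (clear m) v))"
  shows "MV \<turnstile> Seq m \<theta> (Eq (subst_tm (clear m) t) (subst_tm (clear m) v))"
  using assms by (rule derivable_eq_trans) simp_all

lemma ideal_formula_ideal: "ideal (formula_ideal m \<theta>)"
  unfolding ideal_def
proof (intro conjI ballI allI impI)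
  show "0 \<in> formula_ideal m \<theta>"
    using formula_ideal_iff[of Zero] wf by (simp add: cls_simps derivable_eq_refl)
next
  fix x y assume xy: "x \<in> formula_ideal m \<theta>" "y \<in> formula_ideal m \<theta>"
  obtain t where [simp]: "x = cls t" by (rule cls_surj)
  obtain u where [simp]: "y = cls u" by (rule cls_surj)
  have "MV \<turnstile> Seq m \<theta> (Eq (subst_tm (clear m) (Plus t u)) (subst_tm (clear m) (Plus Zero Zero)))"
    using xy wf by (auto simp: formula_ideal_iff intro!: derivable_eq_Plus)
  moreover have "MV \<turnstile> Seq m \<theta> (Eq (subst_tm (clear m) (Plus Zero Zero)) (subst_tm (clear m) Zero))"
    by (rule derivable_mv_eq_clear) (simp add: cls_simps)
  ultimately have "MV \<turnstile> Seq m \<theta> (Eq (subst_tm (clear m) (Plus t u)) (subst_tm (clear m) Zero))"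
    by (rule derivable_eq_trans) simp_all
  then show "x + y \<in> formula_ideal m \<theta>"
    using formula_ideal_iff[of "Plus t u"] by (simp add: cls_simps)
next
  fix x y assume xy: "x \<sqsubseteq> y" "y \<in> formula_ideal m \<theta>"
  obtain t where [simp]: "x = cls t" by (rule cls_surj)
  obtain u where [simp]: "y = cls u" by (rule cls_surj)
  let ?n = "Neg (Plus (Neg t) u)" and ?c = "subst_tm (clear m)"
  have "MV \<turnstile> Seq m \<theta> (Eq (?c t) (?c (Neg (Plus (Neg t) Zero))))"
    by (rule derivable_mv_eq_clear) (simp add: cls_simps)
  moreover have "MV \<turnstile> Seq m \<theta> (Eq (?c (Neg (Plus (Neg t) Zero))) (?c ?n))"
  proof -
    have "MV \<turnstile> Seq m \<theta> (Eq (?c (Plus (Neg t) Zero)) (?c (Plus (Neg t) u)))"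
    proof -
      have "MV \<turnstile> Seq m \<theta> (Eq (?c u) Zero)" using xy(2) by (simp add: formula_ideal_iff)
      then have "MV \<turnstile> Seq m \<theta> (Eq Zero (?c u))" using wf by (rule derivable_eq_sym) simp_all
      then show ?thesis using wf by (simp add: derivable_eq_Plus derivable_eq_refl)
    qed
    from derivable_eq_Neg[OF this wf] show ?thesis by simp
  qed
  moreover have "MV \<turnstile> Seq m \<theta> (Eq (?c ?n) (?c Zero))"
    using xy(1) by (intro derivable_mv_eq_clear) (simp add: cls_simps below_def monus_def)
  ultimately have "MV \<turnstile> Seq m \<theta> (Eq (?c t) (?c Zero))"
    by (blast intro: clear_eq_trans)
  then show "x \<in> formula_ideal m \<theta>"
    using formula_ideal_iff[of t] by simp
qed

text \<open>
  From left to right this is antisymmetry of the order, carried out inside the calculus: if both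
  differences are zero, then \<open>t\<close> and \<open>u\<close> are equal to the two sides of the axiom of
  Lukasiewicz.
\<close>

lemma congr_formula_ideal_iff:
  "congr (formula_ideal m \<theta>) (cls t) (cls u) \<longleftrightarrow>
    MV \<turnstile> Seq m \<theta> (Eq (subst_tm (clear m) t) (subst_tm (clear m) u))"
proof
  let ?c = "subst_tm (clear m)" and ?n = "\<lambda>t u. Neg (Plus (Neg t) u)"
  have mem: "cls t \<ominus> cls u \<in> formula_ideal m \<theta> \<longleftrightarrow> MV \<turnstile> Seq m \<theta> (Eq (?c (?n t u)) Zero)" for t u
    using formula_ideal_iff[of "?n t u"] by (simp add: cls_simps monus_def)
  {
    assume "congr (formula_ideal m \<theta>) (cls t) (cls u)"
    then have tu: "MV \<turnstile> Seq m \<theta> (Eq (?c (?n t u)) Zero)" "MV \<turnstile> Seq m \<theta> (Eq (?c (?n u t)) Zero)"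
      by (simp_all add: congr_def mem)
    have *: "MV \<turnstile> Seq m \<theta> (Eq (?c (Plus (?n t u) u)) (?c u))"
      if "MV \<turnstile> Seq m \<theta> (Eq (?c (?n t u)) Zero)" for t u
    proof -
      have "MV \<turnstile> Seq m \<theta> (Eq (?c (Plus (?n t u) u)) (?c (Plus Zero u)))"
        using that wf by (auto intro!: derivable_eq_Plus derivable_eq_refl)
      moreover have "MV \<turnstile> Seq m \<theta> (Eq (?c (Plus Zero u)) (?c u))"
        by (rule derivable_mv_eq_clear) (simp add: cls_simps)
      ultimately show ?thesis by (rule clear_eq_trans)
    qed
    have "MV \<turnstile> Seq m \<theta> (Eq (?c (Plus (?n u t) t)) (?c (Plus (?n t u) u)))"
      by (rule derivable_mv_eq_clear) (simp only: cls_simps mv_algebra_class.lukasiewicz)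
    then have "MV \<turnstile> Seq m \<theta> (Eq (?c (Plus (?n u t) t)) (?c u))"
      using *[OF tu(1)] by (rule clear_eq_trans)
    moreover have "MV \<turnstile> Seq m \<theta> (Eq (?c t) (?c (Plus (?n u t) t)))"
      using *[OF tu(2)] wf by (rule derivable_eq_sym) simp_all
    ultimately show "MV \<turnstile> Seq m \<theta> (Eq (?c t) (?c u))"
      by (blast intro: clear_eq_trans)
  }
  {
    assume tu: "MV \<turnstile> Seq m \<theta> (Eq (?c t) (?c u))"
    have *: "MV \<turnstile> Seq m \<theta> (Eq (?c (?n t u)) Zero)"
      if "MV \<turnstile> Seq m \<theta> (Eq (?c t) (?c u))" for t u
    proof -
      have "MV \<turnstile> Seq m \<theta> (Eq (?c (Plus (Neg t) u)) (?c (Plus (Neg u) u)))"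
        using that wf by (auto intro!: derivable_eq_Plus derivable_eq_Neg derivable_eq_refl)
      then have "MV \<turnstile> Seq m \<theta> (Eq (?c (?n t u)) (?c (?n u u)))"
        using wf by (auto dest: derivable_eq_Neg)
      moreover have "MV \<turnstile> Seq m \<theta> (Eq (?c (?n u u)) (?c Zero))"
        using add_neg[of "cls u"]
        by (intro derivable_mv_eq_clear) (simp add: cls_simps add.commute)
      ultimately have "MV \<turnstile> Seq m \<theta> (Eq (?c (?n t u)) (?c Zero))"
        by (rule clear_eq_trans)
      then show ?thesis by simp
    qed
    show "congr (formula_ideal m \<theta>) (cls t) (cls u)"
      unfolding congr_def mem using * tu derivable_eq_sym[OF tu wf] by simp
  }
qed

lemma congr_clear: "congr (formula_ideal m \<theta>) (cls t) (cls (subst_tm (clear m) t))"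
  unfolding congr_formula_ideal_iff subst_clear[OF wf_subst_clear]
  by (simp add: derivable_eq_refl wf)

end

text \<open>
  A substitution \<open>r\<close> under which \<open>\<theta>'\<close> proves \<open>\<theta>\<close> is a morphism of contexts
  from \<open>\<theta>'\<close> to \<open>\<theta>\<close>, and forcing is stable under pullback along it.
\<close>

lemma forces_pullback:
  assumes "forces \<phi> (formula_ideal m \<theta>) (\<lambda>i. cls (s i))"
    and wf: "wf_fm m \<theta>" "wf_fm m' \<theta>'" "\<And>i. wf_tm m (s i)" "\<And>i. i < m \<Longrightarrow> wf_tm m' (r i)"
    and "MV \<turnstile> Seq m' \<theta>' (subst_fm r \<theta>)"
  shows "forces \<phi> (formula_ideal m' \<theta>') (\<lambda>i. cls (subst_tm r (s i)))"
proof -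
  define f where "f = subst_free (\<lambda>i. subst_tm r (clear m i))"
  have f: "f (cls t) = cls (subst_tm r (subst_tm (clear m) t))" for t
    by (simp add: f_def subst_free_cls subst_tm_comp)
  have "f ` formula_ideal m \<theta> \<subseteq> formula_ideal m' \<theta>'"
  proof clarify
    fix x assume "x \<in> formula_ideal m \<theta>"
    then obtain t where x: "x = cls t" and "MV \<turnstile> Seq m \<theta> (Eq (subst_tm (clear m) t) Zero)"
      by (auto simp: formula_ideal_def)
    from this(2) wf(4) have "MV \<turnstile> Seq m' (subst_fm r \<theta>) (subst_fm r (Eq (subst_tm (clear m) t) Zero))"
      by (rule derivable.subst)
    then have "MV \<turnstile> Seq m' \<theta>' (Eq (subst_tm r (subst_tm (clear m) t)) Zero)"
      using derivable.cut[OF assms(6)] by simp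
    moreover have "wf_tm m' (subst_tm r (subst_tm (clear m) t))"
      using wf(4) by (rule wf_subst_tm[OF wf_subst_clear])
    ultimately show "f x \<in> formula_ideal m' \<theta>'"
      by (simp add: x f formula_ideal_iff[OF wf(2)] subst_clear)
  qed
  then have "forces \<phi> (formula_ideal m' \<theta>') (\<lambda>i. f (cls (s i)))"
    using assms(1) unfolding f_def
    by (intro forces_image[OF _ mv_hom_subst_free]) (auto intro: ideal_formula_ideal wf)
  then show ?thesis by (simp add: f subst_clear wf)
qed

section \<open>Forcing and derivability of cartesian formulae\<close>

lemma cartesian_fm_wf: "cartesian_fm T n \<phi> \<Longrightarrow> wf_fm n \<phi>"
  by (induction rule: cartesian_fm.induct) simp_all

text \<open>
  For arbitrary formulae the equation can fail in the presence of \<open>Disj I F\<close>, because substitution also acts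
  on the values of \<open>F\<close> outside \<open>I\<close>, which need not be well-formed in the context.
\<close>

lemma cartesian_fm_subst_cong:
  assumes "cartesian_fm T n \<phi>" "\<And>i. i < n \<Longrightarrow> \<sigma> i = \<tau> i"
  shows "subst_fm \<sigma> \<phi> = subst_fm \<tau> \<phi>"
  using assms
proof (induction arbitrary: \<sigma> \<tau>)
  case (1 n s t)
  then show ?case by (metis subst_fm.simps(1) subst_tm_cong)
next
  case (3 n \<phi> \<psi>)
  then show ?case by (metis subst_fm.simps(3))
next
  case (4 n \<phi>)
  have "subst_fm (lift_subst \<sigma>) \<phi> = subst_fm (lift_subst \<tau>) \<phi>"
    by (rule "4.IH") (auto simp: lift_subst_def "4.prems" split: nat.split)
  then show ?case by simp
qed simp

lemma uniqueness_forced: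
  assumes "T \<turnstile> uniqueness_seq n \<phi>"
    and T: "\<And>\<sigma> I. \<sigma> \<in> T \<Longrightarrow> ideal (I :: 'a::mv_algebra set) \<Longrightarrow> holds_in I \<sigma>"
    and "ideal (I :: 'a set)" "forces \<phi> I (case_nat x s)" "forces \<phi> I (case_nat y s)"
  shows "congr I x y"
proof -
  let ?s = "case_nat y (case_nat x s)"
  let ?\<sigma> = "\<lambda>i. case i of 0 \<Rightarrow> Var 0 | Suc j \<Rightarrow> Var (j + 2)"
  have "(\<lambda>i. eval ?s (?\<sigma> i)) = case_nat y s"
    by (auto split: nat.split)
  then have "forces (subst_fm ?\<sigma> \<phi>) I ?s"
    using assms(5) by (simp only: forces_subst)
  moreover have "forces (subst_fm shift \<phi>) I ?s"
    using assms(4) by (simp only: forces_shift)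
  moreover have "holds_in I (uniqueness_seq n \<phi>)"
    using assms(1) T assms(3) by (rule soundness)
  ultimately have "congr I (eval ?s (Var 1)) (eval ?s (Var 0))"
    unfolding uniqueness_seq_def holds_in.simps forces.simps by blast
  then show ?thesis by simp
qed

text \<open>
  Global sections preserve cartesian formulae. In the existential case, provable uniqueness makes the
  local witnesses glue to one element of the free algebra, and clearing its superfluous variables
  gives a term in context that witnesses the quantifier in the calculus.
\<close>

lemma forced_imp_derivable:
  assumes "cartesian_fm T n \<phi>"
    and T: "\<And>\<sigma> I. \<sigma> \<in> T \<Longrightarrow> ideal (I :: free_mv set) \<Longrightarrow> holds_in I \<sigma>"
    and "wf_fm m \<theta>" "\<And>i. wf_tm m (s i)"
    and "forces \<phi> (formula_ideal m \<theta>) (\<lambda>i. cls (s i))"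
  shows "MV \<turnstile> Seq m \<theta> (subst_fm s \<phi>)"
  using assms(1,4,5)
proof (induction arbitrary: s)
  case (1 n t u)
  have "wf_tm m (subst_tm s v)" for v
    by (induction v) (simp_all add: 1)
  then show ?case
    using 1 by (simp add: eval_cls congr_formula_ideal_iff[OF assms(3)] subst_clear)
next
  case (2 n)
  then show ?case by (simp add: derivable.top assms(3))
next
  case (3 n \<phi> \<psi>)
  then show ?case by (simp add: derivable.and_intro)
next
  case (4 n \<phi>)
  let ?I = "formula_ideal m \<theta>" and ?s = "\<lambda>i. cls (s i)"
  have I: "ideal ?I" using assms(3) by (rule ideal_formula_ideal)
  have "covered (\<lambda>J. \<exists>x. forces \<phi> J (case_nat x ?s)) ?I"
    using "4.prems"(2) by simp
  then have "\<exists>x. forces \<phi> ?I (case_nat x ?s)"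
    using I
  proof (rule glue)
    fix J :: "free_mv set" and x y
    assume J: "ideal J"
    show "congr J x y" if "forces \<phi> J (case_nat x ?s)" "forces \<phi> J (case_nat y ?s)"
      using "4.hyps"(2) T J that by (rule uniqueness_forced)
    show "forces \<phi> J (case_nat y ?s)" if "forces \<phi> J (case_nat x ?s)" "congr J x y"
      using that(1) J by (rule forces_congr) (auto simp: that(2) J congr_refl split: nat.split)
  qed (erule (3) forces_mono, erule (1) forces_local[rotated])
  then obtain x where x: "forces \<phi> ?I (case_nat x ?s)" by blast
  obtain t0 where t0: "x = cls t0" by (rule cls_surj)
  define t where "t = subst_tm (clear m) t0"
  have "forces \<phi> ?I (case_nat (cls t) ?s)"
    using x I by (rule forces_congr)
      (auto simp: t0 t_def congr_clear[OF assms(3)] congr_refl[OF I] split: nat.split)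
  also have "case_nat (cls t) ?s = (\<lambda>i. cls (case_nat t s i))"
    by (auto split: nat.split)
  finally have "MV \<turnstile> Seq m \<theta> (subst_fm (case_nat t s) \<phi>)"
    by (intro "4.IH") (auto simp: t_def "4.prems" split: nat.split)
  then show ?case
  proof (rule derivable_Ex_witness)
    show "wf_tm m t" by (simp add: t_def)
    have "wf_fm n (Ex \<phi>)" using cartesian_fm_wf[OF "4.hyps"(1)] by simp
    then show "wf_fm m (subst_fm s (Ex \<phi>))" by (rule wf_subst_fm) (simp add: "4.prems")
  qed
qed

text \<open>
  The generic situation in which \<open>\<phi>\<close> holds need not live in the context of \<open>\<phi>\<close>,
  because an existential quantifier is witnessed only after its bound variable has been added to the
  context. The hypothesis therefore ranges over all contexts \<open>\<theta>'\<close> over \<open>\<theta>\<close> that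
  force \<open>\<phi>\<close>, and the induction adds the parts of \<open>\<phi>\<close> to the context one after the
  other.
\<close>

lemma derivable_from_generic:
  assumes "cartesian_fm T n \<phi>" "\<And>i. wf_tm m (s i)" "wf_fm m \<theta>" "wf_fm m \<chi>"
    and "\<And>m' r \<theta>'. (\<And>i. i < m \<Longrightarrow> wf_tm m' (r i)) \<Longrightarrow> wf_fm m' \<theta>' \<Longrightarrow>
      MV \<turnstile> Seq m' \<theta>' (subst_fm r \<theta>) \<Longrightarrow>
      forces \<phi> (formula_ideal m' \<theta>') (\<lambda>i. cls (subst_tm r (s i))) \<Longrightarrow>
      MV \<turnstile> Seq m' \<theta>' (subst_fm r \<chi>)"
  shows "MV \<turnstile> Seq m (And \<theta> (subst_fm s \<phi>)) \<chi>"
  using assms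
proof (induction arbitrary: m s \<theta> \<chi>)
  case (1 n t u)
  have wf: "wf_tm m (subst_tm s v)" for v
    by (induction v) (simp_all add: 1)
  let ?\<theta> = "And \<theta> (subst_fm s (Eq t u))"
  have \<theta>: "wf_fm m ?\<theta>" using 1 wf by simp
  have "MV \<turnstile> Seq m ?\<theta> (subst_fm Var \<chi>)"
  proof (rule "1.prems"(4))
    show "MV \<turnstile> Seq m ?\<theta> (subst_fm Var \<theta>)"
      using \<theta> by (simp add: derivable.and_left)
    show "forces (Eq t u) (formula_ideal m ?\<theta>) (\<lambda>i. cls (subst_tm Var (s i)))"
      using \<theta> unfolding forces.simps subst_tm_Var eval_cls congr_formula_ideal_iff[OF \<theta>]
      by (simp add: subst_clear[OF wf] derivable.and_right)
  qed (use \<theta> in simp_all)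
  then show ?case by simp
next
  case (2 n)
  have "MV \<turnstile> Seq m \<theta> (subst_fm Var \<chi>)"
    by (rule "2.prems"(4)) (simp_all add: 2 derivable.ident)
  then show ?case
    using derivable.cut[OF derivable.and_left[OF "2.prems"(2), of Top]] by simp
next
  case (3 n \<phi> \<psi>)
  let ?\<phi> = "subst_fm s \<phi>" and ?\<psi> = "subst_fm s \<psi>"
  have wf: "wf_fm m ?\<phi>" "wf_fm m ?\<psi>"
    using "3.hyps"[THEN cartesian_fm_wf] "3.prems"(1) by (blast intro: wf_subst_fm)+
  \<comment> \<open>The second conjunct first waits in the context as a mere antecedent. Once \<open>\<phi>\<close> is
    forced, a second pass makes \<open>\<psi>\<close> forced as well, and pullback keeps \<open>\<phi>\<close>
    forced.\<close>
  have "MV \<turnstile> Seq m (And (And \<theta> ?\<psi>) ?\<phi>) \<chi>"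
  proof (rule "3.IH"(1))
    fix m' r and \<theta>' :: "'a fm"
    assume r: "\<And>i. i < m \<Longrightarrow> wf_tm m' (r i)" and \<theta>': "wf_fm m' \<theta>'"
      and \<theta>'_imp: "MV \<turnstile> Seq m' \<theta>' (subst_fm r (And \<theta> ?\<psi>))"
      and \<phi>: "forces \<phi> (formula_ideal m' \<theta>') (\<lambda>i. cls (subst_tm r (s i)))"
    have wf': "wf_fm m' (subst_fm r \<theta>)" "wf_fm m' (subst_fm r ?\<psi>)" "wf_fm m' (subst_fm r \<chi>)"
      using r "3.prems"(2,3) wf(2) by (blast intro: wf_subst_fm)+
    have s': "wf_tm m' (subst_tm r (s i))" for i
      using "3.prems"(1) r by (blast intro: wf_subst_tm)
    have imp: "MV \<turnstile> Seq m' \<theta>' (subst_fm r \<theta>)" "MV \<turnstile> Seq m' \<theta>' (subst_fm r ?\<psi>)"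
      using \<theta>'_imp derivable.and_left[OF wf'(1,2)] derivable.and_right[OF wf'(1,2)]
      by (auto intro: derivable.cut)
    have "MV \<turnstile> Seq m' (And \<theta>' (subst_fm (\<lambda>i. subst_tm r (s i)) \<psi>)) (subst_fm r \<chi>)"
    proof (rule "3.IH"(2)[OF s' \<theta>' wf'(3)])
      fix m'' q and \<theta>'' :: "'a fm"
      assume q: "\<And>i. i < m' \<Longrightarrow> wf_tm m'' (q i)" and \<theta>'': "wf_fm m'' \<theta>''"
        and \<theta>''_imp: "MV \<turnstile> Seq m'' \<theta>'' (subst_fm q \<theta>')"
        and \<psi>: "forces \<psi> (formula_ideal m'' \<theta>'') (\<lambda>i. cls (subst_tm q (subst_tm r (s i))))"
      have "MV \<turnstile> Seq m'' \<theta>'' (subst_fm (\<lambda>i. subst_tm q (r i)) \<chi>)"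
      proof (rule "3.prems"(4))
        show "wf_tm m'' (subst_tm q (r i))" if "i < m" for i
          using r[OF that] q by (rule wf_subst_tm)
        have "MV \<turnstile> Seq m'' (subst_fm q \<theta>') (subst_fm q (subst_fm r \<theta>))"
          using imp(1) q by (rule derivable.subst)
        then show "MV \<turnstile> Seq m'' \<theta>'' (subst_fm (\<lambda>i. subst_tm q (r i)) \<theta>)"
          using derivable.cut[OF \<theta>''_imp] by (simp add: subst_fm_comp)
        show "forces (And \<phi> \<psi>) (formula_ideal m'' \<theta>'')
            (\<lambda>i. cls (subst_tm (\<lambda>i. subst_tm q (r i)) (s i)))"
          using forces_pullback[OF \<phi> \<theta>' \<theta>'' s' q \<theta>''_imp] \<psi> by (simp add: subst_tm_comp)
      qed (fact \<theta>'')
      then show "MV \<turnstile> Seq m'' \<theta>'' (subst_fm q (subst_fm r \<chi>))"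
        by (simp add: subst_fm_comp)
    qed
    then show "MV \<turnstile> Seq m' \<theta>' (subst_fm r \<chi>)"
      using imp(2) derivable.cut derivable.and_intro[OF derivable.ident[OF \<theta>']]
      by (metis subst_fm_comp)
  qed (use 3 wf in simp_all)
  moreover have "MV \<turnstile> Seq m (And \<theta> (And ?\<phi> ?\<psi>)) (And (And \<theta> ?\<psi>) ?\<phi>)"
  proof -
    have "MV \<turnstile> Seq m (And \<theta> (And ?\<phi> ?\<psi>)) \<theta>" "MV \<turnstile> Seq m (And \<theta> (And ?\<phi> ?\<psi>)) (And ?\<phi> ?\<psi>)"
      using "3.prems"(2) wf by (auto intro: derivable.and_left derivable.and_right)
    then show ?thesis
      using derivable.cut[OF _ derivable.and_left[OF wf]] derivable.cut[OF _ derivable.and_right[OF wf]]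
      by (intro derivable.and_intro)
  qed
  ultimately show ?case by (simp add: derivable.cut)
next
  case (4 n \<phi>)
  have wf_\<phi>: "wf_fm (Suc m) (subst_fm (lift_subst s) \<phi>)"
    using cartesian_fm_wf[OF "4.hyps"(1)] by (rule wf_subst_fm) (rule wf_lift_subst[OF "4.prems"(1)])
  have "MV \<turnstile> Seq (Suc m) (And (subst_fm shift \<theta>) (subst_fm (lift_subst s) \<phi>)) (subst_fm shift \<chi>)"
  proof (rule "4.IH")
    show "wf_tm (Suc m) (lift_subst s i)" for i
      using "4.prems"(1) by (auto simp: lift_subst_def wf_shift_tm split: nat.split)
    show "wf_fm (Suc m) (subst_fm shift \<theta>)" "wf_fm (Suc m) (subst_fm shift \<chi>)"
      using "4.prems"(2,3) by (auto intro: wf_shift_fm)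
  next
    fix m' r and \<theta>' :: "'a fm"
    assume r: "\<And>i. i < Suc m \<Longrightarrow> wf_tm m' (r i)" and \<theta>': "wf_fm m' \<theta>'"
      and imp: "MV \<turnstile> Seq m' \<theta>' (subst_fm r (subst_fm shift \<theta>))"
      and \<phi>: "forces \<phi> (formula_ideal m' \<theta>') (\<lambda>i. cls (subst_tm r (lift_subst s i)))"
    have "(\<lambda>i. cls (subst_tm r (lift_subst s i))) =
        case_nat (cls (r 0)) (\<lambda>i. cls (subst_tm (\<lambda>i. r (Suc i)) (s i)))"
      by (auto simp: lift_subst_def split: nat.split)
    with \<phi> have "forces (Ex \<phi>) (formula_ideal m' \<theta>') (\<lambda>i. cls (subst_tm (\<lambda>i. r (Suc i)) (s i)))"
      by (auto intro: covered.leaf)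
    then show "MV \<turnstile> Seq m' \<theta>' (subst_fm r (subst_fm shift \<chi>))"
      unfolding subst_fm_shift
      using r \<theta>' imp by (intro "4.prems"(4)) (simp_all add: subst_fm_shift)
  qed
  then show ?case
    using derivable_Ex_left[OF _ "4.prems"(2) wf_\<phi> "4.prems"(3)] by simp
qed

text \<open>
  The argument applies to every theory whose axioms are forced over the free MV-algebra, for
  instance also to the theory of linearly ordered MV-algebras.
\<close>

theorem cartesian_sequent_derivable:
  assumes "cartesian_seq T \<sigma>" "T \<turnstile> \<sigma>"
    and T: "\<And>\<sigma> I. \<sigma> \<in> T \<Longrightarrow> ideal (I :: free_mv set) \<Longrightarrow> holds_in I \<sigma>"
  shows "MV \<turnstile> \<sigma>"
proof (cases \<sigma>)
  case (Seq n \<phi> \<psi>)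
  with assms(1) have cart: "cartesian_fm T n \<phi>" "cartesian_fm T n \<psi>" by simp_all
  have clear: "subst_fm (clear n) \<phi> = \<phi>"
    using cartesian_fm_subst_cong[OF cart(1), of "clear n" Var] by (simp add: clear_def)
  have "MV \<turnstile> Seq n (And Top (subst_fm (clear n) \<phi>)) \<psi>"
  proof (rule derivable_from_generic[OF cart(1)])
    fix m' r and \<theta>' :: "'a fm"
    assume r: "\<And>i. i < n \<Longrightarrow> wf_tm m' (r i)" and \<theta>': "wf_fm m' \<theta>'"
      and \<phi>: "forces \<phi> (formula_ideal m' \<theta>') (\<lambda>i. cls (subst_tm r (clear n i)))"
    have "holds_in (formula_ideal m' \<theta>') \<sigma>"
      using assms(2) T ideal_formula_ideal[OF \<theta>'] by (rule soundness)
    with \<phi> Seq have "forces \<psi> (formula_ideal m' \<theta>') (\<lambda>i. cls (subst_tm r (clear n i)))"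
      by simp
    then have "MV \<turnstile> Seq m' \<theta>' (subst_fm (\<lambda>i. subst_tm r (clear n i)) \<psi>)"
      using wf_subst_tm[OF wf_clear r]
      by (intro forced_imp_derivable[OF cart(2) T \<theta>']) blast+
    also have "subst_fm (\<lambda>i. subst_tm r (clear n i)) \<psi> = subst_fm r \<psi>"
      by (rule cartesian_fm_subst_cong[OF cart(2)]) (simp add: clear_def)
    finally show "MV \<turnstile> Seq m' \<theta>' (subst_fm r \<psi>)" .
  qed (use cart cartesian_fm_wf in auto)
  moreover have "MV \<turnstile> Seq n \<phi> (And Top \<phi>)"
    using cartesian_fm_wf[OF cart(1)] by (intro derivable.and_intro derivable.top derivable.ident)
  ultimately show ?thesis
    unfolding Seq clear by (blast intro: derivable.cut)
qed

lemma MV_cartesian: "\<sigma> \<in> MV \<Longrightarrow> cartesian_seq T \<sigma> \<and> wf_seq \<sigma>"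
  unfolding MV_def Let_def by (auto intro!: cartesian_fm.intros)

theorem proposition4p2:
  "same_theory (cartesianization (Loc :: 'i seq set)) MV"
  unfolding same_theory_def
proof (intro allI iffI)
  fix \<sigma> :: "'i seq"
  assume "cartesianization Loc \<turnstile> \<sigma>"
  then show "MV \<turnstile> \<sigma>"
    by (rule derivable_transfer)
      (auto simp: cartesianization_def intro: cartesian_sequent_derivable Loc_holds_in)
next
  fix \<sigma> :: "'i seq"
  assume "MV \<turnstile> \<sigma>"
  then show "cartesianization Loc \<turnstile> \<sigma>"
  proof (rule derivable_transfer)
    fix \<tau> :: "'i seq" assume \<tau>: "\<tau> \<in> MV" "wf_seq \<tau>"
    then have "Loc \<turnstile> \<tau>" by (intro derivable.ax) (simp_all add: Loc_def)
    then have "\<tau> \<in> cartesianization Loc" using MV_cartesian[OF \<tau>(1)] by (simp add: cartesianization_def)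
    then show "cartesianization Loc \<turnstile> \<tau>" using \<tau>(2) by (rule derivable.ax)
  qed
qed

end
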